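(* Let ${\bf d}=(d_1,\dots,d_{n+1})$ be the reduction vector of a fat point subscheme $A_0\subset\mathbb{P}^2$ with respect to some totally reducing sequence of lines $L_1,\dots,L_{n+1}$. If ${\bf d}$ is GMS, then for every $t\ge0$ $$\max(h'_0,\dots,h'_{n+1})=\binom{t-n+1}{2}+\sum_{i=0}^{n}\binom{t-i-d_{i+1}+1}{1},$$ where $h'_{n+1}=\binom{t-(n+1)+2}{2}$ and $h'_i=\binom{t-i+2}{2}-\sum_{j=i+1}^{n+1}d_j$ for $0\le i\le n$; consequently both equal $\dim_K (I_{A_0})_t$, and $h_{A_0}=f_{\bf d}=F_{\bf d}$.
   Context: Fat point schemes in $\mathbb{P}^2$ over an algebraically closed field $K$ (any characteristic), $R=K[x_0,x_1,x_2]$, $I_Z=\bigcap I_{p_i}^{m_i}$, $h_Z(t)=\dim_K(R/I_Z)_t$. Residual of $A=\sum a_ip_i$ by a line $L$: multiplicities of points on $L$ are lowered by one (not below $0$), others unchanged. A sequence of lines $L_1,\dots,L_{n+1}$ with $A_j=A_{j-1}:L_j$ totally reduces $A_0$ if $A_{n+1}=\varnothing$; its reduction vector has $d_j=$ sum of multiplicities of $A_{j-1}$ at points on $L_j$. A non-negative, non-increasing integer vector ${\bf v}=(v_1,\dots,v_r)$ is GMS if $v_i-v_j\ge j-i-1$ for all $1\le i<j\le r$. Binomial convention: $\binom{a}{k}=0$ if $a<k$. $f_{\bf v}(t)=\sum_{i=0}^{n}\binom{\min(t-i+1,v_{i+1})}{1}$, $F_{\bf v}(t)=\min_{0\le i\le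 n+1}\big(\binom{t+2}{2}-\binom{t-i+2}{2}+\sum_{j=i+1}^{n+1}v_j\big)$. *)

theory Defs
  imports "HOL-Computational_Algebra.Polynomial" "HOL-Library.Poly_Mapping"
begin

definition bnm :: "int \<Rightarrow> nat \<Rightarrow> int" where
  "bnm a k = (if a < int k then 0 else int (nat a choose k))"

text \<open>A point of P^2 is represented by a nonzero coordinate triple; a line by the nonzero
  coefficient triple of its linear form.\<close>

type_synonym 'k triple = "'k \<times> 'k \<times> 'k"

definition smult3 :: "'k::field \<Rightarrow> 'k triple \<Rightarrow> 'k triple" where
  "smult3 c p = (case p of (a, b, e) \<Rightarrow> (c * a, c * b, c * e))"

definition coord :: "'k::field triple \<Rightarrow> nat \<Rightarrow> 'k" where
  "coord p i = (case p of (a, b, e) \<Rightarrow> (if i = 0 then a else if i = 1 then b else e))"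

definition on_line :: "'k::field triple \<Rightarrow> 'k triple \<Rightarrow> bool" where
  "on_line L p = (case L of (a, b, e) \<Rightarrow> case p of (x, y, z) \<Rightarrow> a * x + b * y + e * z = 0)"

text \<open>A fat point scheme  A = sum m(p) p  is given by a finite set P of pairwise distinct
  projective points (nonzero, pairwise non-proportional representatives) together with a
  multiplicity function m.\<close>

definition fat_point_support :: "'k::field triple set \<Rightarrow> bool" where
  "fat_point_support P \<longleftrightarrow> finite P \<and> (0, 0, 0) \<notin> P \<and>
     (\<forall>p\<in>P. \<forall>q\<in>P. p \<noteq> q \<longrightarrow> \<not> (\<exists>c. q = smult3 c p))"

definition residual :: "'k::field triple \<Rightarrow> ('k triple \<Rightarrow> nat) \<Rightarrow> ('k triple \<Rightarrow> nat)" where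
  "residual L m = (\<lambda>p. if on_line L p then m p - 1 else m p)"

primrec res_seq :: "('k::field triple \<Rightarrow> nat) \<Rightarrow> (nat \<Rightarrow> 'k triple) \<Rightarrow> nat \<Rightarrow> ('k triple \<Rightarrow> nat)" where
  "res_seq m L 0 = m"
| "res_seq m L (Suc j) = residual (L (Suc j)) (res_seq m L j)"

definition totally_reduces ::
  "'k::field triple set \<Rightarrow> ('k triple \<Rightarrow> nat) \<Rightarrow> (nat \<Rightarrow> 'k triple) \<Rightarrow> nat \<Rightarrow> bool" where
  "totally_reduces P m L n \<longleftrightarrow> (\<forall>j\<in>{1..n+1}. L j \<noteq> (0, 0, 0)) \<and>
     (\<forall>p\<in>P. res_seq m L (n + 1) p = 0)"

definition red_vec :: "'k::field triple set \<Rightarrow> ('k triple \<Rightarrow> nat) \<Rightarrow> (nat \<Rightarrow> 'k triple) \<Rightarrow> nat \<Rightarrow> nat" where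
  "red_vec P m L j = (\<Sum>p\<in>{p\<in>P. on_line (L j) p}. res_seq m L (j - 1) p)"

text \<open>GMS for a vector v = (v_1,...,v_r) (indices 1..r); non-negativity is automatic (nat).\<close>
definition is_GMS :: "nat \<Rightarrow> (nat \<Rightarrow> nat) \<Rightarrow> bool" where
  "is_GMS r v \<longleftrightarrow> (\<forall>i j. 1 \<le> i \<and> i < j \<and> j \<le> r \<longrightarrow>
      v j \<le> v i \<and> int (v i) - int (v j) \<ge> int j - int i - 1)"

definition f_vec :: "nat \<Rightarrow> (nat \<Rightarrow> nat) \<Rightarrow> nat \<Rightarrow> int" where
  "f_vec n v t = (\<Sum>i=0..n. bnm (min (int t - int i + 1) (int (v (i + 1)))) 1)"

definition F_vec :: "nat \<Rightarrow> (nat \<Rightarrow> nat) \<Rightarrow> nat \<Rightarrow> int" where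
  "F_vec n v t = Min ((\<lambda>i. bnm (int t + 2) 2 - bnm (int t - int i + 2) 2
        + (\<Sum>j=i+1..n+1. int (v j))) ` {0..n+1})"

type_synonym 'k mpoly = "(nat \<Rightarrow>\<^sub>0 nat) \<Rightarrow>\<^sub>0 'k"

definition Rpolys :: "'k::field mpoly set" where
  "Rpolys = {f. \<forall>mon\<in>Poly_Mapping.keys f. Poly_Mapping.keys mon \<subseteq> {0, 1, 2}}"

definition forms_deg :: "nat \<Rightarrow> 'k::field mpoly set" where
  "forms_deg t = {f\<in>Rpolys. \<forall>mon\<in>Poly_Mapping.keys f. (\<Sum>i\<in>{0, 1, 2}. Poly_Mapping.lookup mon i) = t}"

definition peval :: "'k::field mpoly \<Rightarrow> (nat \<Rightarrow> 'k) \<Rightarrow> 'k" where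
  "peval f x = (\<Sum>mon\<in>Poly_Mapping.keys f. Poly_Mapping.lookup f mon * (\<Prod>i\<in>Poly_Mapping.keys mon. x i ^ Poly_Mapping.lookup mon i))"

definition pscale :: "'k::field \<Rightarrow> 'k mpoly \<Rightarrow> 'k mpoly" where
  "pscale c f = Poly_Mapping.single 0 c * f"

text \<open>The (homogeneous) ideal I_p of a point p: polynomials vanishing on the cone over p.\<close>
definition point_ideal :: "'k::field triple \<Rightarrow> 'k mpoly set" where
  "point_ideal p = {f\<in>Rpolys. \<forall>c. peval f (coord (smult3 c p)) = 0}"

inductive_set ideal_prod :: "'k::field mpoly set \<Rightarrow> 'k mpoly set \<Rightarrow> 'k mpoly set"
  for I J where
  zero: "0 \<in> ideal_prod I J"
| add: "a \<in> I \<Longrightarrow> b \<in> J \<Longrightarrow> s \<in> ideal_prod I J \<Longrightarrow> a * b + s \<in> ideal_prod I J"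

primrec ideal_pow :: "'k::field mpoly set \<Rightarrow> nat \<Rightarrow> 'k mpoly set" where
  "ideal_pow I 0 = Rpolys"
| "ideal_pow I (Suc k) = ideal_prod I (ideal_pow I k)"

definition fat_ideal :: "'k::field triple set \<Rightarrow> ('k triple \<Rightarrow> nat) \<Rightarrow> 'k mpoly set" where
  "fat_ideal P m = Rpolys \<inter> (\<Inter>p\<in>P. ideal_pow (point_ideal p) (m p))"

definition kdim :: "'k::field mpoly set \<Rightarrow> nat" where
  "kdim S = vector_space.dim pscale S"

definition fat_ideal_dim :: "'k::field triple set \<Rightarrow> ('k triple \<Rightarrow> nat) \<Rightarrow> nat \<Rightarrow> nat" where
  "fat_ideal_dim P m t = kdim (fat_ideal P m \<inter> forms_deg t)"

text \<open>h_Z(t) = dim_K (R/I_Z)_t = dim_K R_t - dim_K (I_Z)_t.\<close>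
definition hilb :: "'k::field triple set \<Rightarrow> ('k triple \<Rightarrow> nat) \<Rightarrow> nat \<Rightarrow> int" where
  "hilb P m t = int (kdim (forms_deg t :: 'k mpoly set)) - int (fat_ideal_dim P m t)"

end

theory Submission
  imports Defs
begin

text \<open>
  Upper bound: restricting the forms of degree \<open>t\<close> in \<open>I\<^sub>A\<close> to a line \<open>L\<close> gives univariate
  polynomials of degree at most \<open>t\<close> whose roots, counted with multiplicity, include the
  \<open>d\<close> points of \<open>A\<close> on \<open>L\<close>; the kernel is \<open>L\<close> times the forms of degree \<open>t - 1\<close> in the ideal
  of the residual. Hence \<open>dim (I\<^sub>A)\<^sub>t \<le> dim (I\<^sub>A\<^sub>:\<^sub>L)\<^sub>t\<^sub>-\<^sub>1 + max (t + 1 - d) 0\<close>, and iterating along the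
  reducing sequence yields the right-hand side. Lower bound: multiplication by \<open>L\<^sub>1 \<dots> L\<^sub>i\<close> embeds
  \<open>(I\<^sub>A\<^sub>i)\<^sub>t\<^sub>-\<^sub>i\<close> into \<open>(I\<^sub>A\<^sub>0)\<^sub>t\<close>, and \<open>A\<^sub>i\<close> imposes at most \<open>deg A\<^sub>i = d\<^sub>i\<^sub>+\<^sub>1 + \<dots> + d\<^sub>n\<^sub>+\<^sub>1\<close> conditions, so the
  dimension is at least every \<open>h'\<^sub>i\<close>. The GMS condition makes the two bounds meet.

  All local computations are done after a linear change of coordinates that moves the point to
  \<open>(1, 0, 0)\<close> and the line to a coordinate line: there \<open>I\<^sub>p\<^sup>k\<close> is spanned by the monomials of degree
  at least \<open>k\<close> in \<open>x\<^sub>1, x\<^sub>2\<close>, and multiplication by the line shifts exponents.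
\<close>

section \<open>The two bounds for GMS vectors\<close>

lemma bnm_1: "bnm a 1 = max a 0"
  by (auto simp: bnm_def)

text \<open>Pascal's rule. For negative \<open>a\<close> both binomials are cut off to 0, which
  \<open>max\<close> reproduces.\<close>

lemma bnm_2_step: "bnm (a + 1) 2 = bnm a 2 + max a 0"
proof (cases "a < 1")
  case False
  then obtain k where k: "a = int k + 1"
    by (metis add.commute le_add_diff_inverse not_less zero_le_imp_eq_int diff_ge_0_iff_ge)
  have "nat (2 + int k) = Suc (Suc k)" "nat (1 + int k) = Suc k" by auto
  then show ?thesis
    by (cases "k = 0") (auto simp: k bnm_def numeral_2_eq_2 add.commute)
qed (auto simp: bnm_def)

text \<open>Iterated Pascal's rule. The binomial left over is the one on the right-hand side of the
  theorem, so every h'_i becomes comparable with that side term by term.\<close>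

lemma bnm_2_telescope:
  assumes "i \<le> n + 1"
  shows "bnm (int t - int i + 2) 2 = bnm (int t - int n + 1) 2 + (\<Sum>k=i..n. max (int t - int k + 1) 0)"
  using assms
proof (induction i rule: inc_induct)
  case base
  then show ?case by (simp add: algebra_simps)
next
  case (step i)
  have "{i..n} = insert i {Suc i..n}" using step.hyps by auto
  then show ?case
    using step.IH bnm_2_step[of "int t - int i + 1"] by (simp add: algebra_simps)
qed

lemma bnm_2_telescope_0:
  "bnm (int t + 2) 2 = bnm (int t - int n + 1) 2 + (\<Sum>k=0..n. max (int t - int k + 1) 0)"
  using bnm_2_telescope[of 0 n t] by simp

context
  fixes n t :: nat and d :: "nat \<Rightarrow> nat"
begin

text \<open>The candidate h'_i. For \<open>i = n + 1\<close> the sum is empty, so the one formula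
  also covers the last candidate.\<close>

definition hcand :: "nat \<Rightarrow> int" where
  "hcand i = bnm (int t - int i + 2) 2 - (\<Sum>j=i+1..n+1. int (d j))"

definition hsum :: int where
  "hsum = bnm (int t - int n + 1) 2 + (\<Sum>i=0..n. bnm (int t - int i - int (d (i + 1)) + 1) 1)"

lemma hcand_eq:
  assumes "i \<le> n + 1"
  shows "hcand i = bnm (int t - int n + 1) 2
    + (\<Sum>k=i..n. max (int t - int k + 1) 0 - int (d (k + 1)))"
  using bnm_2_telescope[OF assms, of t] sum.shift_bounds_cl_nat_ivl[of "\<lambda>j. int (d j)" i 1 n]
  by (simp add: hcand_def sum_subtractf)

text \<open>Termwise, \<open>max x 0 - d\<close> is at most \<open>max (x - d) 0\<close> for
  \<open>d \<ge> 0\<close>, and the summands added for \<open>k < i\<close> are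
  non-negative.\<close>

lemma hcand_le_hsum:
  assumes "i \<le> n + 1"
  shows "hcand i \<le> hsum"
proof -
  have "(\<Sum>k=i..n. max (int t - int k + 1) 0 - int (d (k + 1)))
      \<le> (\<Sum>k=i..n. max (int t - int k - int (d (k + 1)) + 1) 0)"
    by (rule sum_mono) auto
  also have "\<dots> \<le> (\<Sum>k=0..n. max (int t - int k - int (d (k + 1)) + 1) 0)"
    by (rule sum_mono2) auto
  finally show ?thesis
    by (simp add: hcand_eq[OF assms] hsum_def bnm_1[simplified])
qed

text \<open>The GMS condition says that \<open>t - k - d\<^sub>k\<^sub>+\<^sub>1 + 1\<close> can drop by at most one as \<open>k\<close>
  grows, so that from the first positive value on no value is negative.\<close>

lemma hsum_attained:
  assumes "is_GMS (n + 1) d"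
  shows "\<exists>i\<le>n+1. hcand i = hsum"
proof -
  define a where "a k = int t - int k - int (d (k + 1)) + 1" for k
  have a_step: "a k \<le> a l + 1" if "k < l" "l \<le> n" for k l
  proof -
    have "int (d (k + 1)) - int (d (l + 1)) \<ge> int (l + 1) - int (k + 1) - 1"
      using assms that unfolding is_GMS_def
      by (metis One_nat_def Suc_eq_plus1 Suc_le_mono add_mono_thms_linordered_field(1) le_add2)
    then show ?thesis by (simp add: a_def)
  qed
  \<comment> \<open>The first index with a positive value is where h'_i reaches the bound; the
    alternative \<open>i = n + 1\<close> covers the case that there is none.\<close>
  define i where "i = (LEAST i. i = n + 1 \<or> a i > 0)"
  have i: "i = n + 1 \<or> a i > 0"
    unfolding i_def by (rule LeastI[of _ "n + 1"]) simp
  have below: "a k \<le> 0" "k \<noteq> n + 1" if "k < i" for k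
    using not_less_Least[OF that[unfolded i_def]] by auto
  have i_le: "i \<le> n + 1"
    unfolding i_def by (rule Least_le) simp
  have above: "a k \<ge> 0" if "i \<le> k" "k \<le> n" for k
    using a_step[of i k] i that by (cases "k = i") auto
  \<comment> \<open>Before \<open>i\<close> the truncated values vanish. From \<open>i\<close> on
    \<open>a k \<ge> 0\<close>, hence \<open>t - k + 1 \<ge> d (k + 1) \<ge> 0\<close> and neither
    truncation has an effect.\<close>
  have "(\<Sum>k=0..n. max (a k) 0) = (\<Sum>k=i..n. max (int t - int k + 1) 0 - int (d (k + 1)))"
  proof (rule sum.mono_neutral_cong_right)
    show "\<forall>k\<in>{0..n} - {i..n}. max (a k) 0 = 0"
      using below by (auto simp: not_le)
    show "max (a k) 0 = max (int t - int k + 1) 0 - int (d (k + 1))" if "k \<in> {i..n}" for k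
      using above[of k] that by (auto simp: a_def)
  qed auto
  then have "hcand i = hsum"
    by (simp add: hcand_eq[OF i_le] hsum_def bnm_1[simplified] a_def)
  then show ?thesis using i_le by blast
qed

lemma Max_hcand:
  assumes "is_GMS (n + 1) d"
  shows "Max (hcand ` {0..n+1}) = hsum"
proof (rule Max_eqI)
  show "y \<le> hsum" if "y \<in> hcand ` {0..n+1}" for y
    using that hcand_le_hsum by auto
  show "hsum \<in> hcand ` {0..n+1}"
    using hsum_attained[OF assms] by (metis atLeastAtMost_iff image_eqI le0)
qed auto

text \<open>For \<open>d \<ge> 0\<close> the value \<open>min x d\<close>, cut off at 0, equals
  \<open>max x 0 - max (x - d) 0\<close>. Summed over \<open>x = t - k + 1\<close>, the first terms
  telescope and the second are those of \<open>hsum\<close>.\<close>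

lemma f_vec_eq: "f_vec n d t = bnm (int t + 2) 2 - hsum"
proof -
  have "(\<Sum>k=0..n. max (min (int t - int k + 1) (int (d (k + 1)))) 0)
      = (\<Sum>k=0..n. max (int t - int k + 1) 0 - max (int t - int k - int (d (k + 1)) + 1) 0)"
    by (rule sum.cong) auto
  then show ?thesis
    using bnm_2_telescope_0[of t n] by (simp add: f_vec_def hsum_def bnm_1[simplified] sum_subtractf)
qed

text \<open>The quantity minimised is a constant minus h'_i, so the minimum sits where h'_i is
  largest.\<close>

lemma F_vec_eq:
  assumes "is_GMS (n + 1) d"
  shows "F_vec n d t = bnm (int t + 2) 2 - hsum"
proof -
  have F: "F_vec n d t = Min ((\<lambda>i. bnm (int t + 2) 2 - hcand i) ` {0..n+1})"
    by (simp add: F_vec_def hcand_def algebra_simps)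
  show ?thesis
    unfolding F
  proof (rule Min_eqI)
    show "bnm (int t + 2) 2 - hsum \<le> y"
      if "y \<in> (\<lambda>i. bnm (int t + 2) 2 - hcand i) ` {0..n+1}" for y
      using that hcand_le_hsum by auto
    show "bnm (int t + 2) 2 - hsum \<in> (\<lambda>i. bnm (int t + 2) 2 - hcand i) ` {0..n+1}"
      using hsum_attained[OF assms] by (metis (mono_tags) atLeastAtMost_iff image_eqI le0)
  qed auto
qed

end

section \<open>Dimension of common kernels\<close>

context vector_space
begin

text \<open>A basis of the kernel and one vector outside it span \<open>V\<close>. The finite set
  \<open>B\<close> keeps bases finite: \<open>dim\<close> is a cardinality, and the polynomial ring
  as a whole has infinite dimension.\<close>

lemma dim_le_ker_add_1:
  assumes V: "subspace V" "V \<subseteq> span B" "finite B"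
    and add: "\<And>x y. x \<in> V \<Longrightarrow> y \<in> V \<Longrightarrow> \<phi> (x + y) = \<phi> x + \<phi> y"
    and scl: "\<And>c x. x \<in> V \<Longrightarrow> \<phi> (scale c x) = c * \<phi> x"
  shows "dim V \<le> dim {x\<in>V. \<phi> x = 0} + 1"
proof -
  let ?W = "{x\<in>V. \<phi> x = 0}"
  obtain C where C: "C \<subseteq> ?W" "independent C" "?W \<subseteq> span C" "card C = dim ?W"
    using basis_exists[of ?W] by blast
  have "finite C"
    using independent_span_bound[OF \<open>finite B\<close> C(2)] C(1) V(2) by auto
  show ?thesis
  proof (cases "\<forall>x\<in>V. \<phi> x = 0")
    case True
    then have "?W = V" by auto
    then show ?thesis by simp
  next
    case False
    then obtain v where v: "v \<in> V" "\<phi> v \<noteq> 0" by auto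
    have "V \<subseteq> span (insert v C)"
    proof
      fix x assume x: "x \<in> V"
      \<comment> \<open>Adding this multiple of \<open>v\<close> moves \<open>x\<close> into the
        kernel.\<close>
      let ?c = "- (\<phi> x / \<phi> v)"
      have cv: "scale ?c v \<in> V" by (rule subspace_scale[OF V(1) v(1)])
      have "\<phi> (x + scale ?c v) = 0"
        unfolding add[OF x cv] scl[OF v(1)] using v(2) by simp
      moreover have "x + scale ?c v \<in> V" by (rule subspace_add[OF V(1) x cv])
      ultimately have "x + scale ?c v \<in> span (insert v C)"
        using C(3) span_mono[of C "insert v C"] by auto
      then have "(x + scale ?c v) - scale ?c v \<in> span (insert v C)"
        by (intro span_diff span_scale) (auto intro: span_base)
      then show "x \<in> span (insert v C)" by simp
    qed
    then have "dim V \<le> card (insert v C)"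
      by (rule dim_le_card) (simp add: \<open>finite C\<close>)
    also have "\<dots> \<le> card C + 1"
      by (simp add: card_insert_if \<open>finite C\<close>)
    finally show ?thesis using C(4) by simp
  qed
qed

text \<open>Each functional cuts the common kernel of the earlier ones by at most one dimension. The
  lower bound applies this to coefficients, the upper bound to evaluations at points of a
  line.\<close>

lemma dim_le_kers_add_card:
  assumes "finite I" and V: "subspace V" "V \<subseteq> span B" "finite B"
    and add: "\<And>i x y. i \<in> I \<Longrightarrow> x \<in> V \<Longrightarrow> y \<in> V \<Longrightarrow> \<phi> i (x + y) = \<phi> i x + \<phi> i y"
    and scl: "\<And>i c x. i \<in> I \<Longrightarrow> x \<in> V \<Longrightarrow> \<phi> i (scale c x) = c * \<phi> i x"
  shows "dim V \<le> dim {x\<in>V. \<forall>i\<in>I. \<phi> i x = 0} + card I"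
  using \<open>finite I\<close> add scl
proof (induction I rule: finite_induct)
  case empty
  then show ?case by simp
next
  case (insert i I)
  let ?W = "{x\<in>V. \<forall>i\<in>I. \<phi> i x = 0}"
  have sub: "subspace ?W"
    unfolding subspace_def
  proof (intro conjI ballI allI)
    have z: "(0::'b) \<in> V" by (rule subspace_0[OF V(1)])
    have "\<phi> k 0 = 0" if "k \<in> I" for k
      using insert.prems(2)[of k 0 0] z that by simp
    with z show "0 \<in> ?W" by auto
  qed (use insert.prems V(1) in \<open>auto simp: subspace_add subspace_scale\<close>)
  have "dim V \<le> dim ?W + card I"
    by (rule insert.IH) (use insert.prems in auto)
  also have "dim ?W \<le> dim {x\<in>?W. \<phi> i x = 0} + 1"
    by (rule dim_le_ker_add_1[OF sub _ V(3)]) (use V(2) insert.prems in auto)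
  also have "{x\<in>?W. \<phi> i x = 0} = {x\<in>V. \<forall>k\<in>insert i I. \<phi> k x = 0}"
    by auto
  finally show ?case using insert.hyps by simp
qed

lemma dim_subset_finite_span:
  assumes "V \<subseteq> W" "W \<subseteq> span B" "finite B"
  shows "dim V \<le> dim W"
proof -
  obtain C where C: "C \<subseteq> W" "independent C" "W \<subseteq> span C" "card C = dim W"
    using basis_exists[of W] by blast
  have "finite C"
    using independent_span_bound[OF assms(3) C(2)] C(1) assms(2) by auto
  with dim_le_card[of V C] assms(1) C(3,4) show ?thesis by auto
qed

end

lemma (in vector_space) dim_image_linear_inj:
  assumes "Vector_Spaces.linear scale scale g" "inj g"
  shows "dim (g ` V) = dim V"
proof -
  interpret g: Vector_Spaces.linear scale scale g by fact
  obtain C where C: "C \<subseteq> V" "independent C" "V \<subseteq> span C" "card C = dim V"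
    using basis_exists[of V] by blast
  have "card (g ` C) = dim V"
    using C(4) assms(2) card_image[of g C] inj_on_subset by (metis subset_UNIV)
  moreover have "independent (g ` C)"
    using C(2) assms(2) by (simp add: g.independent_injective_image inj_on_subset)
  moreover have "g ` V \<subseteq> span (g ` C)"
    using C(3) g.span_image[of C] by auto
  ultimately show ?thesis
    using C(1) by (intro dim_unique[of "g ` C"]) auto
qed

section \<open>Substitution homomorphisms\<close>

text \<open>Coefficient maps for substitutions: the identity for evaluation at points, constants in
  \<open>'k poly\<close> for restriction to a line, constants in \<open>'k mpoly\<close> for changes
  of coordinates. A substitution is again such a map, so substitutions compose.\<close>

locale unital_hom =
  fixes h :: "'a::comm_ring_1 \<Rightarrow> 'b::comm_ring_1"
  assumes hom_add: "h (a + b) = h a + h b"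
    and hom_mult: "h (a * b) = h a * h b"
    and hom_one: "h 1 = 1"
begin

lemma hom_zero: "h 0 = 0"
  using hom_add[of 0 0] by simp

lemma hom_sum: "h (sum g A) = (\<Sum>a\<in>A. h (g a))"
  by (induction A rule: infinite_finite_induct) (auto simp: hom_zero hom_add)

lemma hom_prod: "h (prod g A) = (\<Prod>a\<in>A. h (g a))"
  by (induction A rule: infinite_finite_induct) (auto simp: hom_one hom_mult)

lemma hom_power: "h (a ^ n) = h a ^ n"
  by (induction n) (auto simp: hom_one hom_mult)

end

lemma unital_hom_id: "unital_hom (\<lambda>c. c)"
  by unfold_locales auto

lemma unital_hom_const_poly: "unital_hom (\<lambda>c. [:c:])"
  by unfold_locales (auto simp: one_pCons)

lemma unital_hom_poly: "unital_hom (\<lambda>p. poly p x)"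
  by unfold_locales auto

lemma unital_hom_single: "unital_hom (Poly_Mapping.single (0 :: 'a::comm_monoid_add))"
  by unfold_locales (auto simp: single_add mult_single)

definition monv :: "(nat \<Rightarrow> 'a::comm_ring_1) \<Rightarrow> (nat \<Rightarrow>\<^sub>0 nat) \<Rightarrow> 'a" where
  "monv x mon = (\<Prod>i\<in>Poly_Mapping.keys mon. x i ^ Poly_Mapping.lookup mon i)"

lemma monv_superset:
  assumes "finite S" "Poly_Mapping.keys mon \<subseteq> S"
  shows "monv x mon = (\<Prod>i\<in>S. x i ^ Poly_Mapping.lookup mon i)"
  unfolding monv_def
  by (rule prod.mono_neutral_left) (use assms in \<open>auto simp: in_keys_iff\<close>)

lemma monv_add: "monv x (a + b) = monv x a * monv x b"
proof -
  let ?S = "Poly_Mapping.keys a \<union> Poly_Mapping.keys b"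
  have "monv x (a + b) = (\<Prod>i\<in>?S. x i ^ Poly_Mapping.lookup (a + b) i)"
    by (rule monv_superset) (use keys_add[of a b] in auto)
  then show ?thesis
    by (simp add: monv_superset[of ?S] lookup_add power_add prod.distrib)
qed

lemma monv_0 [simp]: "monv x 0 = 1"
  by (simp add: monv_def)

lemma monv_single [simp]: "monv x (Poly_Mapping.single i k) = x i ^ k"
  by (cases "k = 0") (auto simp: monv_def)

lemma monv_cong:
  assumes "\<And>i. i \<in> Poly_Mapping.keys mon \<Longrightarrow> x i = y i"
  shows "monv x mon = monv y mon"
  unfolding monv_def using assms by (intro prod.cong) auto

definition psubst ::
  "('k::comm_ring_1 \<Rightarrow> 'a::comm_ring_1) \<Rightarrow> (nat \<Rightarrow> 'a) \<Rightarrow> ((nat \<Rightarrow>\<^sub>0 nat) \<Rightarrow>\<^sub>0 'k) \<Rightarrow> 'a" where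
  "psubst h x f = (\<Sum>mon\<in>Poly_Mapping.keys f. h (Poly_Mapping.lookup f mon) * monv x mon)"

lemma peval_eq_psubst: "peval f x = psubst (\<lambda>c. c) x f"
  by (simp add: peval_def psubst_def monv_def)

lemma poly_mapping_eq_sum_single:
  "f = (\<Sum>k\<in>Poly_Mapping.keys f. Poly_Mapping.single k (Poly_Mapping.lookup f k))"
  by (rule poly_mapping_eqI) (auto simp: lookup_sum lookup_single when_def in_keys_iff)

lemma mult_eq_sum_single:
  "f * g = (\<Sum>a\<in>Poly_Mapping.keys f. \<Sum>b\<in>Poly_Mapping.keys g.
     Poly_Mapping.single (a + b) (Poly_Mapping.lookup f a * Poly_Mapping.lookup g b))"
  by (subst poly_mapping_eq_sum_single[of f], subst poly_mapping_eq_sum_single[of g])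
     (simp only: sum_product mult_single)

lemma psubst_cong:
  assumes "\<And>mon i. mon \<in> Poly_Mapping.keys f \<Longrightarrow> i \<in> Poly_Mapping.keys mon \<Longrightarrow> x i = y i"
  shows "psubst h x f = psubst h y f"
  unfolding psubst_def using assms by (intro sum.cong arg_cong2[where f = "(*)"] monv_cong) auto

context unital_hom
begin

lemma psubst_superset:
  assumes "finite S" "Poly_Mapping.keys f \<subseteq> S"
  shows "psubst h x f = (\<Sum>mon\<in>S. h (Poly_Mapping.lookup f mon) * monv x mon)"
  unfolding psubst_def
  by (rule sum.mono_neutral_left) (use assms in \<open>auto simp: in_keys_iff hom_zero\<close>)

lemma psubst_add: "psubst h x (f + g) = psubst h x f + psubst h x g"
proof -
  let ?S = "Poly_Mapping.keys f \<union> Poly_Mapping.keys g"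
  have "psubst h x (f + g) = (\<Sum>mon\<in>?S. h (Poly_Mapping.lookup (f + g) mon) * monv x mon)"
    by (rule psubst_superset) (use keys_add[of f g] in auto)
  then show ?thesis
    by (simp add: psubst_superset[of ?S] lookup_add hom_add distrib_right sum.distrib)
qed

lemma psubst_0 [simp]: "psubst h x 0 = 0"
  by (simp add: psubst_def)

lemma psubst_sum: "psubst h x (sum g A) = (\<Sum>a\<in>A. psubst h x (g a))"
  by (induction A rule: infinite_finite_induct) (auto simp: psubst_add)

lemma psubst_single: "psubst h x (Poly_Mapping.single mon c) = h c * monv x mon"
  by (cases "c = 0") (auto simp: psubst_def hom_zero)

lemma psubst_mult: "psubst h x (f * g) = psubst h x f * psubst h x g"
proof -
  have "psubst h x (f * g) = (\<Sum>a\<in>Poly_Mapping.keys f. \<Sum>b\<in>Poly_Mapping.keys g.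
     (h (Poly_Mapping.lookup f a) * monv x a) * (h (Poly_Mapping.lookup g b) * monv x b))"
    by (simp add: mult_eq_sum_single[of f g] psubst_sum psubst_single monv_add hom_mult mult_ac)
  then show ?thesis
    by (simp add: psubst_def sum_product)
qed

lemma unital_hom_psubst: "unital_hom (psubst h x)"
proof
  show "psubst h x 1 = 1"
    using psubst_single[of x 0 1] by (simp add: hom_one)
qed (auto simp: psubst_add psubst_mult)

lemma hom_monv: "h (monv x mon) = monv (\<lambda>i. h (x i)) mon"
  by (simp add: monv_def hom_prod hom_power)

lemma hom_psubst: "h (psubst h' x f) = psubst (\<lambda>c. h (h' c)) (\<lambda>i. h (x i)) f"
  by (simp add: psubst_def hom_sum hom_mult hom_monv)

end

definition linform :: "(nat \<Rightarrow> 'k::comm_ring_1) \<Rightarrow> 'k mpoly" where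
  "linform r = (\<Sum>j<3. Poly_Mapping.single (Poly_Mapping.single j 1) (r j))"

text \<open>Pull-back along the linear map \<open>x \<mapsto> M x\<close>. Matrices are functions on
  all of \<open>nat\<close>, of which only the block of indices below 3 is meant.\<close>

definition lsub :: "(nat \<Rightarrow> nat \<Rightarrow> 'k::comm_ring_1) \<Rightarrow> 'k mpoly \<Rightarrow> 'k mpoly" where
  "lsub M = psubst (Poly_Mapping.single 0) (\<lambda>i. linform (M i))"

definition inv3 :: "(nat \<Rightarrow> nat \<Rightarrow> 'k::field) \<Rightarrow> (nat \<Rightarrow> nat \<Rightarrow> 'k) \<Rightarrow> bool" where
  "inv3 M N \<longleftrightarrow> (\<forall>i<3. \<forall>k<3. (\<Sum>j<3. M i j * N j k) = (if i = k then 1 else 0))"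

lemma (in unital_hom) psubst_linform: "psubst h x (linform r) = (\<Sum>j<3. h (r j) * x j)"
  by (simp add: linform_def psubst_sum psubst_single)

lemma (in unital_hom) psubst_lsub:
  "psubst h x (lsub M f) = psubst h (\<lambda>i. \<Sum>j<3. h (M i j) * x j) f"
proof -
  interpret s: unital_hom "psubst h x" by (rule unital_hom_psubst)
  show ?thesis
    unfolding lsub_def s.hom_psubst psubst_single psubst_linform by simp
qed

lemma psubst_id: "psubst (Poly_Mapping.single 0)
  (\<lambda>i. Poly_Mapping.single (Poly_Mapping.single i 1) 1) f = f"
proof -
  have pw: "Poly_Mapping.single (Poly_Mapping.single i 1) (1::'a) ^ k
      = Poly_Mapping.single (Poly_Mapping.single i k) 1" for i :: nat and k :: nat
    by (induction k) (auto simp: mult_single single_add[symmetric])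
  have pr: "(\<Prod>i\<in>A. Poly_Mapping.single (Poly_Mapping.single i (e i)) (1::'a))
      = Poly_Mapping.single (\<Sum>i\<in>A. Poly_Mapping.single i (e i)) 1" for A and e :: "nat \<Rightarrow> nat"
    by (induction A rule: infinite_finite_induct) (auto simp: mult_single)
  have "monv (\<lambda>i. Poly_Mapping.single (Poly_Mapping.single i 1) (1::'a)) mon
      = Poly_Mapping.single mon 1" for mon
    unfolding monv_def pw pr using poly_mapping_eq_sum_single[of mon] by simp
  then show ?thesis
    using poly_mapping_eq_sum_single[of f] by (simp add: psubst_def mult_single)
qed

interpretation lsub: unital_hom "lsub M" for M :: "nat \<Rightarrow> nat \<Rightarrow> 'k::comm_ring_1"
  unfolding lsub_def by (rule unital_hom.unital_hom_psubst[OF unital_hom_single])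

lemma sum_lessThan_3: "(\<Sum>j<3. g j) = g 0 + g 1 + g (2::nat)"
  by (simp add: numeral_3_eq_3 numeral_2_eq_2)

lemma Rpolys_psubst_cong:
  assumes "f \<in> Rpolys" "\<And>i. i < 3 \<Longrightarrow> x i = y i"
  shows "psubst h x f = psubst h y f"
  using assms by (intro psubst_cong) (force simp: Rpolys_def)

lemma lsub_linform: "lsub M (linform r) = linform (\<lambda>j. \<Sum>i<3. r i * M i j)"
  unfolding lsub_def unital_hom.psubst_linform[OF unital_hom_single]
  by (simp add: linform_def sum_distrib_left mult_single single_add algebra_simps sum_lessThan_3)

text \<open>The composite replaces each variable by a coordinate of \<open>N M x = x\<close>.
  Variables of index 3 and above would not be restored, hence \<open>Rpolys\<close>.\<close>

lemma lsub_lsub: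
  assumes "f \<in> Rpolys" "inv3 N M"
  shows "lsub M (lsub N f) = f"
proof -
  have "lsub M (lsub N f) = psubst (Poly_Mapping.single 0)
      (\<lambda>i. \<Sum>j<3. Poly_Mapping.single 0 (N i j) * linform (M j)) f"
    unfolding lsub_def[of M] by (rule unital_hom.psubst_lsub[OF unital_hom_single])
  also have "\<dots> = psubst (Poly_Mapping.single 0)
      (\<lambda>i. Poly_Mapping.single (Poly_Mapping.single i 1) 1) f"
  proof (rule Rpolys_psubst_cong[OF assms(1)])
    fix i :: nat assume i: "i < 3"
    have "(\<Sum>j<3. Poly_Mapping.single 0 (N i j) * linform (M j))
        = lsub M (linform (N i))"
      by (simp add: lsub_def unital_hom.psubst_linform[OF unital_hom_single])
    also have "\<dots> = linform (\<lambda>k. \<Sum>j<3. N i j * M j k)"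
      by (rule lsub_linform)
    also have "\<dots> = (\<Sum>k<3. Poly_Mapping.single (Poly_Mapping.single k 1) (if i = k then 1 else 0))"
      unfolding linform_def using assms(2) i by (intro sum.cong) (auto simp: inv3_def)
    also have "\<dots> = (\<Sum>k<3. if i = k then Poly_Mapping.single (Poly_Mapping.single k 1) 1 else 0)"
      by (intro sum.cong) auto
    also have "\<dots> = Poly_Mapping.single (Poly_Mapping.single i 1) 1"
      using i by simp
    finally show "(\<Sum>j<3. Poly_Mapping.single 0 (N i j) * linform (M j))
        = Poly_Mapping.single (Poly_Mapping.single i 1) 1" .
  qed
  also have "\<dots> = f" by (rule psubst_id)
  finally show ?thesis .
qed

section \<open>Polynomials with prescribed monomials\<close>

definition supported :: "(nat \<Rightarrow>\<^sub>0 nat) set \<Rightarrow> 'k::field mpoly set" where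
  "supported S = {f. Poly_Mapping.keys f \<subseteq> S}"

lemma supported_0 [simp]: "0 \<in> supported S"
  by (simp add: supported_def)

lemma supported_add: "f \<in> supported S \<Longrightarrow> g \<in> supported S \<Longrightarrow> f + g \<in> supported S"
  using keys_add[of f g] by (auto simp: supported_def)

lemma supported_sum: "(\<And>a. a \<in> A \<Longrightarrow> g a \<in> supported S) \<Longrightarrow> sum g A \<in> supported S"
  by (induction A rule: infinite_finite_induct) (auto simp: supported_add)

lemma supported_single: "mon \<in> S \<Longrightarrow> Poly_Mapping.single mon c \<in> supported S"
  by (simp add: supported_def)

lemma supported_mult:
  assumes "f \<in> supported S" "g \<in> supported T" "\<And>a b. a \<in> S \<Longrightarrow> b \<in> T \<Longrightarrow> a + b \<in> U"
  shows "f * g \<in> supported U"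
  using keys_mult[of f g] assms by (fastforce simp: supported_def)

lemma lookup_mult_single:
  "Poly_Mapping.lookup (Poly_Mapping.single a c * f) (a + b) = c * Poly_Mapping.lookup (f :: 'k::field mpoly) b"
proof -
  have "Poly_Mapping.single a c * f
      = (\<Sum>k\<in>Poly_Mapping.keys f. Poly_Mapping.single (a + k) (c * Poly_Mapping.lookup f k))"
    by (subst poly_mapping_eq_sum_single[of f]) (simp add: sum_distrib_left mult_single)
  then show ?thesis
    by (auto simp: lookup_sum lookup_single when_def in_keys_iff)
qed

text \<open>Multiplication by a monomial shifts exponents injectively, so nothing cancels. This
  decides membership of a product with a line once the line is a coordinate line.\<close>

lemma supported_mult_single_iff:
  assumes "c \<noteq> 0" "f \<in> supported T" "\<And>b. b \<in> T \<Longrightarrow> a + b \<in> U \<longleftrightarrow> b \<in> S"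
  shows "Poly_Mapping.single a c * f \<in> supported U \<longleftrightarrow> f \<in> supported S"
proof
  assume l: "Poly_Mapping.single a c * f \<in> supported U"
  show "f \<in> supported S"
    unfolding supported_def
  proof safe
    fix b assume b: "b \<in> Poly_Mapping.keys f"
    then have "a + b \<in> Poly_Mapping.keys (Poly_Mapping.single a c * f)"
      using assms(1) by (simp add: in_keys_iff lookup_mult_single)
    with l assms(2,3) b show "b \<in> S" by (auto simp: supported_def)
  qed
next
  assume "f \<in> supported S"
  then have f: "f \<in> supported (S \<inter> T)" using assms(2) by (auto simp: supported_def)
  have "Poly_Mapping.single a c \<in> supported {a}"
    by (simp add: supported_single)
  then show "Poly_Mapping.single a c * f \<in> supported U"
    by (rule supported_mult[OF _ f]) (use assms(3) in auto)
qed

definition tmon :: "(nat \<Rightarrow>\<^sub>0 nat) set" where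
  "tmon = {mon. Poly_Mapping.keys mon \<subseteq> {0, 1, 2}}"

definition tdeg :: "(nat \<Rightarrow>\<^sub>0 nat) \<Rightarrow> nat" where
  "tdeg mon = Poly_Mapping.lookup mon 0 + Poly_Mapping.lookup mon 1 + Poly_Mapping.lookup mon 2"

text \<open>The degree in the two local coordinates at \<open>(1, 0, 0)\<close>; it measures the
  order of vanishing there.\<close>

definition ndeg :: "(nat \<Rightarrow>\<^sub>0 nat) \<Rightarrow> nat" where
  "ndeg mon = Poly_Mapping.lookup mon 1 + Poly_Mapping.lookup mon 2"

lemma tmon_add: "a \<in> tmon \<Longrightarrow> b \<in> tmon \<Longrightarrow> a + b \<in> tmon"
  using keys_add[of a b] by (auto simp: tmon_def)

lemma tmon_add_iff: "a + b \<in> tmon \<longleftrightarrow> a \<in> tmon \<and> b \<in> tmon"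
  by (auto simp: tmon_def in_keys_iff lookup_add subset_iff)

lemma tmon_0 [simp]: "0 \<in> tmon"
  by (simp add: tmon_def)

lemma tmon_single: "i < 3 \<Longrightarrow> Poly_Mapping.single i k \<in> tmon"
  by (auto simp: tmon_def)

lemma tdeg_add: "tdeg (a + b) = tdeg a + tdeg b"
  by (simp add: tdeg_def lookup_add)

lemma ndeg_add: "ndeg (a + b) = ndeg a + ndeg b"
  by (simp add: ndeg_def lookup_add)

lemma Rpolys_eq: "Rpolys = supported tmon"
  by (auto simp: Rpolys_def supported_def tmon_def)

lemma forms_deg_eq: "forms_deg t = supported {mon\<in>tmon. tdeg mon = t}"
  by (auto simp: forms_deg_def Rpolys_eq supported_def tdeg_def add.assoc)

lemma forms_deg_subset_Rpolys: "forms_deg t \<subseteq> Rpolys"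
  by (auto simp: forms_deg_def)

lemma Rpolys_mult: "f \<in> Rpolys \<Longrightarrow> g \<in> Rpolys \<Longrightarrow> f * g \<in> Rpolys"
  unfolding Rpolys_eq by (rule supported_mult) (auto intro: tmon_add)

lemma forms_deg_mult: "f \<in> forms_deg s \<Longrightarrow> g \<in> forms_deg t \<Longrightarrow> f * g \<in> forms_deg (s + t)"
  unfolding forms_deg_eq by (rule supported_mult) (auto intro: tmon_add simp: tdeg_add)

lemma linform_in_forms_deg: "linform r \<in> forms_deg 1"
  unfolding linform_def forms_deg_eq
  by (intro supported_sum supported_single)
     (auto simp: tmon_single tdeg_def lookup_single when_def less_Suc_eq numeral_3_eq_3)

lemma linform_in_Rpolys: "linform r \<in> Rpolys"
  using linform_in_forms_deg forms_deg_subset_Rpolys by blast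

lemma const_mult_supported: "f \<in> supported S \<Longrightarrow> Poly_Mapping.single 0 c * f \<in> supported S"
  by (rule supported_mult[OF supported_single[of 0 "{0}"]]) auto

lemma monv_in_forms_deg:
  assumes "mon \<in> tmon" "\<And>i. x i \<in> forms_deg 1"
  shows "monv x mon \<in> forms_deg (tdeg mon)"
proof -
  have one: "1 \<in> forms_deg 0"
    by (auto simp: forms_deg_eq supported_def tdeg_def)
  have pw: "x i ^ k \<in> forms_deg k" for i k
    by (induction k) (use one forms_deg_mult[OF assms(2), of _ ] in auto)
  have "monv x mon = (\<Prod>i\<in>{0,1,2}. x i ^ Poly_Mapping.lookup mon i)"
    by (rule monv_superset) (use assms(1) in \<open>auto simp: tmon_def\<close>)
  also have "\<dots> = x 0 ^ Poly_Mapping.lookup mon 0 * x 1 ^ Poly_Mapping.lookup mon 1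
      * x 2 ^ Poly_Mapping.lookup mon 2"
    by (simp add: mult.assoc)
  also have "\<dots> \<in> forms_deg (tdeg mon)"
    unfolding tdeg_def by (intro forms_deg_mult pw)
  finally show ?thesis .
qed

lemma lsub_in_forms_deg:
  assumes "f \<in> forms_deg t"
  shows "lsub M f \<in> forms_deg t"
  unfolding lsub_def psubst_def forms_deg_eq
  by (intro supported_sum const_mult_supported)
     (use assms monv_in_forms_deg[OF _ linform_in_forms_deg]
       in \<open>fastforce simp: forms_deg_eq supported_def\<close>)

lemma lsub_in_Rpolys:
  assumes "f \<in> Rpolys"
  shows "lsub M f \<in> Rpolys"
  unfolding lsub_def psubst_def Rpolys_eq
proof (intro supported_sum const_mult_supported)
  fix mon assume "mon \<in> Poly_Mapping.keys f"
  then have "mon \<in> tmon" using assms by (auto simp: Rpolys_eq supported_def)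
  then show "monv (\<lambda>i. linform (M i)) mon \<in> supported tmon"
    using monv_in_forms_deg[OF _ linform_in_forms_deg, of mon M] forms_deg_subset_Rpolys
    by (auto simp: Rpolys_eq)
qed

section \<open>Coordinate frames adapted to a point and a line\<close>

definition ldot :: "'k::field triple \<Rightarrow> 'k triple \<Rightarrow> 'k" where
  "ldot L p = (\<Sum>i<3. coord L i * coord p i)"

lemma on_line_iff_ldot: "on_line L p \<longleftrightarrow> ldot L p = 0"
  by (auto simp: on_line_def ldot_def coord_def sum_lessThan_3 split: prod.splits)

definition det3 :: "'k::field triple \<Rightarrow> 'k triple \<Rightarrow> 'k triple \<Rightarrow> 'k" where
  "det3 p u v = coord p 0 * (coord u 1 * coord v 2 - coord u 2 * coord v 1)
    + coord p 1 * (coord u 2 * coord v 0 - coord u 0 * coord v 2)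
    + coord p 2 * (coord u 0 * coord v 1 - coord u 1 * coord v 0)"

definition cols :: "'k::field triple \<Rightarrow> 'k triple \<Rightarrow> 'k triple \<Rightarrow> nat \<Rightarrow> nat \<Rightarrow> 'k" where
  "cols p u v i j = coord (if j = 0 then p else if j = 1 then u else v) i"

lemma all_less_3: "(\<forall>i<3. Q i) \<longleftrightarrow> Q 0 \<and> Q 1 \<and> Q (2::nat)"
  by (auto simp: numeral_3_eq_3 less_Suc_eq numeral_2_eq_2)

lemma cols_invertible:
  assumes "det3 p u v \<noteq> 0"
  shows "\<exists>N. inv3 (cols p u v) N \<and> inv3 N (cols p u v)"
proof -
  obtain p0 p1 p2 u0 u1 u2 v0 v1 v2 where
    [simp]: "p = (p0, p1, p2)" "u = (u0, u1, u2)" "v = (v0, v1, v2)"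
    by (metis prod.exhaust)
  define E where "E = inverse (det3 p u v)"
  have E: "(p0 * (u1 * v2 - u2 * v1) + p1 * (u2 * v0 - u0 * v2) + p2 * (u0 * v1 - u1 * v0)) * E = 1"
    using assms by (simp add: E_def det3_def coord_def)
  \<comment> \<open>The adjugate over the determinant: its rows are the cross products of
    \<open>u\<close> and \<open>v\<close>, of \<open>v\<close> and \<open>p\<close>, and of
    \<open>p\<close> and \<open>u\<close>, scaled by \<open>E\<close>.\<close>
  define N where "N = cols (E * (u1 * v2 - u2 * v1), E * (v1 * p2 - v2 * p1), E * (p1 * u2 - p2 * u1))
    (E * (u2 * v0 - u0 * v2), E * (v2 * p0 - v0 * p2), E * (p2 * u0 - p0 * u2))
    (E * (u0 * v1 - u1 * v0), E * (v0 * p1 - v1 * p0), E * (p0 * u1 - p1 * u0))"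
  have "inv3 (cols p u v) N"
    using E by (simp add: inv3_def all_less_3 sum_lessThan_3 N_def cols_def coord_def algebra_simps)
  moreover have "inv3 N (cols p u v)"
    using E by (simp add: inv3_def all_less_3 sum_lessThan_3 N_def cols_def coord_def algebra_simps)
  ultimately show ?thesis by blast
qed

text \<open>\<open>M\<close> sends \<open>(1, 0, 0)\<close> to \<open>p\<close>, so pulling back by
  \<open>M\<close> moves \<open>p\<close> to \<open>(1, 0, 0)\<close>; \<open>N\<close> leads
  back.\<close>

definition is_frame :: "(nat \<Rightarrow> nat \<Rightarrow> 'k::field) \<Rightarrow> (nat \<Rightarrow> nat \<Rightarrow> 'k) \<Rightarrow> 'k triple \<Rightarrow> bool" where
  "is_frame M N p \<longleftrightarrow> inv3 M N \<and> inv3 N M \<and> (\<forall>i<3. M i 0 = coord p i)"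

text \<open>The columns are \<open>p\<close>, \<open>u\<close>, \<open>v\<close>, on which
  \<open>L\<close> takes the values 0, 1, 0, so that \<open>L\<close> becomes the coordinate
  \<open>x_1\<close>.\<close>

lemma frame_on_line:
  assumes "p \<noteq> (0, 0, 0)" "L \<noteq> (0, 0, 0)" "on_line L p"
  obtains M N where "is_frame M N p"
    "\<And>j. j < 3 \<Longrightarrow> (\<Sum>i<3. coord L i * M i j) = (if j = 1 then 1 else 0)"
proof -
  obtain x y z a b e where [simp]: "p = (x, y, z)" "L = (a, b, e)"
    by (metis prod.exhaust)
  have 0: "a * x + b * y + e * z = 0"
    using assms(3) by (simp add: on_line_def)
  have "a \<noteq> 0 \<or> b \<noteq> 0 \<or> e \<noteq> 0" using assms(2) by auto
  then obtain u0 u1 u2 where 1: "a * u0 + b * u1 + e * u2 = 1"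
  proof (elim disjE)
    assume "a \<noteq> 0" then show ?thesis by (intro that[of "1/a" 0 0]) auto
  next
    assume "b \<noteq> 0" then show ?thesis by (intro that[of 0 "1/b" 0]) auto
  next
    assume "e \<noteq> 0" then show ?thesis by (intro that[of 0 0 "1/e"]) auto
  qed
  let ?u = "(u0, u1, u2)"
  \<comment> \<open>Three candidates for \<open>v\<close> in the kernel of \<open>L\<close>. Up to
    sign the determinants are the coordinates of \<open>p\<close>, and one of these is
    nonzero.\<close>
  have d: "det3 p ?u (b, -a, 0) = - z" "det3 p ?u (e, 0, -a) = y" "det3 p ?u (0, e, -b) = - x"
    using 0 1 by (simp_all add: det3_def coord_def) algebra+
  have "x \<noteq> 0 \<or> y \<noteq> 0 \<or> z \<noteq> 0" using assms(1) by auto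
  then have "\<exists>v. det3 p ?u v \<noteq> 0 \<and> ldot L v = 0"
  proof (elim disjE)
    assume "x \<noteq> 0" with d(3) show ?thesis
      by (intro exI[of _ "(0, e, -b)"]) (simp add: ldot_def sum_lessThan_3, simp add: coord_def)
  next
    assume "y \<noteq> 0" with d(2) show ?thesis
      by (intro exI[of _ "(e, 0, -a)"]) (simp add: ldot_def sum_lessThan_3, simp add: coord_def)
  next
    assume "z \<noteq> 0" with d(1) show ?thesis
      by (intro exI[of _ "(b, -a, 0)"]) (simp add: ldot_def sum_lessThan_3, simp add: coord_def)
  qed
  then obtain v where v: "det3 p ?u v \<noteq> 0" "ldot L v = 0" by blast
  obtain N where N: "inv3 (cols p ?u v) N" "inv3 N (cols p ?u v)"
    using cols_invertible[OF v(1)] by blast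
  show ?thesis
  proof (rule that[of "cols p ?u v" N])
    show "is_frame (cols p ?u v) N p"
      using N by (simp add: is_frame_def cols_def)
    show "(\<Sum>i<3. coord L i * cols p ?u v i j) = (if j = 1 then 1 else 0)" if "j < 3" for j
      using that 0 1 v(2) by (auto simp: cols_def ldot_def sum_lessThan_3 coord_def)
  qed
qed

text \<open>Two vectors spanning the kernel of \<open>L\<close> complete \<open>p\<close> to a
  basis, so that \<open>L\<close> becomes a nonzero multiple of \<open>x_0\<close>. Some choice
  works because the determinants are the coefficients of \<open>L\<close> times the value of
  \<open>L\<close> at \<open>p\<close>.\<close>

lemma frame_off_line:
  assumes "\<not> on_line L p"
  obtains M N where "is_frame M N p"
    "\<And>j. j < 3 \<Longrightarrow> (\<Sum>i<3. coord L i * M i j) = (if j = 0 then ldot L p else 0)"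
proof -
  obtain x y z a b e where [simp]: "p = (x, y, z)" "L = (a, b, e)"
    by (metis prod.exhaust)
  have 0: "a * x + b * y + e * z \<noteq> 0"
    using assms by (simp add: on_line_def)
  have d: "det3 p (b, -a, 0) (e, 0, -a) = a * (a * x + b * y + e * z)"
    "det3 p (b, -a, 0) (0, e, -b) = b * (a * x + b * y + e * z)"
    "det3 p (e, 0, -a) (0, e, -b) = e * (a * x + b * y + e * z)"
    by (simp_all add: det3_def coord_def algebra_simps)
  have "a \<noteq> 0 \<or> b \<noteq> 0 \<or> e \<noteq> 0" using 0 by auto
  then have "\<exists>u v. det3 p u v \<noteq> 0 \<and> ldot L u = 0 \<and> ldot L v = 0"
  proof (elim disjE)
    assume "a \<noteq> 0" with 0 d(1) show ?thesis
      by (intro exI[of _ "(b, -a, 0)"] exI[of _ "(e, 0, -a)"])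
        (simp add: ldot_def sum_lessThan_3, simp add: coord_def)
  next
    assume "b \<noteq> 0" with 0 d(2) show ?thesis
      by (intro exI[of _ "(b, -a, 0)"] exI[of _ "(0, e, -b)"])
        (simp add: ldot_def sum_lessThan_3, simp add: coord_def)
  next
    assume "e \<noteq> 0" with 0 d(3) show ?thesis
      by (intro exI[of _ "(e, 0, -a)"] exI[of _ "(0, e, -b)"])
        (simp add: ldot_def sum_lessThan_3, simp add: coord_def)
  qed
  then obtain u v where uv: "det3 p u v \<noteq> 0" "ldot L u = 0" "ldot L v = 0" by blast
  obtain N where N: "inv3 (cols p u v) N" "inv3 N (cols p u v)"
    using cols_invertible[OF uv(1)] by blast
  show ?thesis
  proof (rule that[of "cols p u v" N])
    show "is_frame (cols p u v) N p"
      using N by (simp add: is_frame_def cols_def)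
    show "(\<Sum>i<3. coord L i * cols p u v i j) = (if j = 0 then ldot L p else 0)" if "j < 3" for j
      using that uv(2,3) by (auto simp: cols_def ldot_def)
  qed
qed

lemma frame_exists:
  assumes "p \<noteq> (0, 0, 0)"
  obtains M N where "is_frame M N p"
proof (cases "on_line (1, 0, 0) p")
  case True
  show ?thesis by (rule frame_on_line[OF assms _ True]) (auto intro: that)
next
  case False
  show ?thesis by (rule frame_off_line[OF False]) (rule that)
qed

section \<open>Powers of the ideal of a point\<close>

text \<open>Over a finite field, 1 plus the product of all \<open>x - a\<close> has no root.\<close>

lemma alg_closed_infinite: "infinite (UNIV :: 'k::alg_closed_field set)"
proof
  assume fin: "finite (UNIV :: 'k set)"
  define q where "q = (\<Prod>a\<in>UNIV. [:- a, 1:] :: 'k poly)"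
  have dq: "degree q = card (UNIV :: 'k set)"
    unfolding q_def by (subst degree_prod_eq_sum_degree) auto
  have "card (UNIV :: 'k set) > 0" using fin by (simp add: card_gt_0_iff)
  then have "degree (q + 1) > 0"
    using dq by (subst degree_add_eq_left) auto
  then obtain z where "poly (q + 1) z = 0"
    using alg_closed_imp_poly_has_root by blast
  moreover have "poly q z = 0"
    unfolding q_def poly_prod using fin by (intro prod_zero) auto
  ultimately show False by simp
qed

text \<open>The \<open>k\<close>-th power of the ideal generated by \<open>x_1\<close> and
  \<open>x_2\<close>, that is, of the ideal of \<open>(1, 0, 0)\<close>, described by its
  monomials.\<close>

definition ord_ge :: "nat \<Rightarrow> 'k::field mpoly set" where
  "ord_ge k = supported {mon\<in>tmon. k \<le> ndeg mon}"

lemma tmon_eq: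
  assumes "mon \<in> tmon"
  shows "mon = Poly_Mapping.single 0 (Poly_Mapping.lookup mon 0)
    + Poly_Mapping.single 1 (Poly_Mapping.lookup mon 1) + Poly_Mapping.single 2 (Poly_Mapping.lookup mon 2)"
  by (rule poly_mapping_eqI)
     (use assms in \<open>auto simp: tmon_def lookup_add lookup_single when_def in_keys_iff subset_iff\<close>)

lemma tmon_eqI:
  assumes "a \<in> tmon" "b \<in> tmon" "\<And>i. i < 3 \<Longrightarrow> Poly_Mapping.lookup a i = Poly_Mapping.lookup b i"
  shows "a = b"
  using tmon_eq[OF assms(1)] tmon_eq[OF assms(2)] assms(3)[of 0] assms(3)[of 1] assms(3)[of 2]
  by simp

text \<open>The monomials that survive the substitution go to distinct powers, so they cannot
  cancel. Used for the restriction to an axis and to a line.\<close>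

lemma psubst_monom_eq_0_iff:
  fixes f :: "'k::field mpoly"
  assumes monv: "\<And>mon. mon \<in> Poly_Mapping.keys f \<Longrightarrow> monv x mon = (if A mon then monom 1 (e mon) else 0)"
    and inj: "inj_on e {mon\<in>Poly_Mapping.keys f. A mon}"
  shows "psubst (\<lambda>c. [:c:]) x f = 0 \<longleftrightarrow> (\<forall>mon\<in>Poly_Mapping.keys f. \<not> A mon)"
proof -
  define F where "F = psubst (\<lambda>c. [:c:]) x f"
  have F: "F = (\<Sum>mon\<in>Poly_Mapping.keys f. if A mon then monom (Poly_Mapping.lookup f mon) (e mon) else 0)"
    unfolding F_def psubst_def by (intro sum.cong) (auto simp: monv smult_monom)
  have "\<not> A mon" if F0: "F = 0" and m: "mon \<in> Poly_Mapping.keys f" for mon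
  proof
    assume A: "A mon"
    have "coeff F (e mon) = (\<Sum>mon'\<in>Poly_Mapping.keys f. if mon' = mon then Poly_Mapping.lookup f mon else 0)"
      unfolding F coeff_sum
      by (intro sum.cong) (use A m inj in \<open>auto simp: inj_on_def\<close>)
    then show False using F0 m by (auto simp: in_keys_iff)
  qed
  moreover have "F = 0" if "\<forall>mon\<in>Poly_Mapping.keys f. \<not> A mon"
    unfolding F using that by (intro sum.neutral) auto
  ultimately show ?thesis unfolding F_def by blast
qed

text \<open>The values on the axis \<open>(c, 0, 0)\<close> form a polynomial in \<open>c\<close>
  whose coefficients belong to the pure powers of \<open>x_0\<close>. Over an infinite field it
  vanishes everywhere only if it is zero.\<close>

lemma ord_ge_1_iff:
  assumes inf: "infinite (UNIV :: 'k::field set)" and f: "(f :: 'k mpoly) \<in> Rpolys"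
  shows "f \<in> ord_ge 1 \<longleftrightarrow> (\<forall>c. psubst (\<lambda>c. c) (\<lambda>i. if i = 0 then c else 0) f = 0)"
proof -
  have keys: "mon \<in> tmon" if "mon \<in> Poly_Mapping.keys f" for mon
    using f that by (auto simp: Rpolys_eq supported_def)
  have monv: "monv (\<lambda>i. if i = 0 then c else 0) mon
      = (if ndeg mon = 0 then c ^ Poly_Mapping.lookup mon 0 else 0)"
    if "mon \<in> tmon" for mon and c :: "'b::comm_ring_1"
    by (subst tmon_eq[OF that]) (auto simp: monv_add ndeg_def power_0_left)
  define F where "F = psubst (\<lambda>c. [:c:]) (\<lambda>i. if i = 0 then [:0, 1:] else 0) f"
  have poly_F: "poly F c = psubst (\<lambda>c. c) (\<lambda>i. if i = 0 then c else 0) f" for c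
  proof -
    have "(\<lambda>i. poly (if i = 0 then [:0, 1:] else 0) c) = (\<lambda>i::nat. if i = 0 then c else 0)"
      by auto
    then show ?thesis
      unfolding F_def unital_hom.hom_psubst[OF unital_hom_poly] by simp
  qed
  have "(\<forall>c. poly F c = 0) \<longleftrightarrow> F = 0"
  proof
    assume "\<forall>c. poly F c = 0"
    then have "{c. poly F c = 0} = UNIV" by auto
    with inf poly_roots_finite[of F] show "F = 0" by auto
  qed simp
  also have "F = 0 \<longleftrightarrow> (\<forall>mon\<in>Poly_Mapping.keys f. \<not> ndeg mon = 0)"
    unfolding F_def
  proof (rule psubst_monom_eq_0_iff)
    show "monv (\<lambda>i. if i = 0 then [:0, 1:] else 0) mon
        = (if ndeg mon = 0 then monom (1::'k) (Poly_Mapping.lookup mon 0) else 0)"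
      if "mon \<in> Poly_Mapping.keys f" for mon
      by (simp add: monv[OF keys[OF that]] monom_altdef)
    show "inj_on (\<lambda>mon. Poly_Mapping.lookup mon 0) {mon\<in>Poly_Mapping.keys f. ndeg mon = 0}"
      by (rule inj_onI, rule tmon_eqI)
         (auto simp: keys ndeg_def numeral_3_eq_3 less_Suc_eq numeral_2_eq_2)
  qed
  also have "\<dots> \<longleftrightarrow> f \<in> ord_ge 1"
    using keys by (auto simp: ord_ge_def supported_def Suc_le_eq)
  finally show ?thesis by (simp add: poly_F)
qed

text \<open>\<open>M\<close> maps the axis of the points \<open>(c, 0, 0)\<close> onto the cone over
  \<open>p\<close>.\<close>

lemma point_ideal_iff:
  fixes p :: "'k::field triple"
  assumes inf: "infinite (UNIV :: 'k set)" and fr: "is_frame M N p"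
  shows "f \<in> point_ideal p \<longleftrightarrow> f \<in> Rpolys \<and> lsub M f \<in> ord_ge 1"
proof (cases "f \<in> Rpolys")
  case True
  have "peval f (coord (smult3 c p)) = psubst (\<lambda>c. c) (\<lambda>i. if i = 0 then c else 0) (lsub M f)" for c
    unfolding peval_eq_psubst unital_hom.psubst_lsub[OF unital_hom_id]
    by (rule Rpolys_psubst_cong[OF True])
       (use fr in \<open>auto simp: is_frame_def sum_lessThan_3 smult3_def coord_def split: prod.splits\<close>)
  then show ?thesis
    using True ord_ge_1_iff[OF inf lsub_in_Rpolys[OF True], of M] by (simp add: point_ideal_def)
qed (simp add: point_ideal_def)

lemma ideal_prod_sum:
  assumes "finite A" "\<And>x. x \<in> A \<Longrightarrow> \<exists>a\<in>I. \<exists>b\<in>J. g x = a * b"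
  shows "sum g A \<in> ideal_prod I J"
  using assms
proof (induction A rule: finite_induct)
  case empty
  then show ?case by (simp add: ideal_prod.zero)
next
  case (insert x A)
  then obtain a b where "a \<in> I" "b \<in> J" "g x = a * b" by blast
  then show ?case
    using insert ideal_prod.add[of a I b J "sum g A"] by simp
qed

lemma ord_ge_add: "f \<in> ord_ge k \<Longrightarrow> g \<in> ord_ge k \<Longrightarrow> f + g \<in> ord_ge k"
  unfolding ord_ge_def by (rule supported_add)

lemma ord_ge_mult: "f \<in> ord_ge j \<Longrightarrow> g \<in> ord_ge k \<Longrightarrow> f * g \<in> ord_ge (j + k)"
  unfolding ord_ge_def by (rule supported_mult) (auto simp: tmon_add ndeg_add)

text \<open>Orders add under products, which gives one direction. Conversely each monomial of order
  at least \<open>k + 1\<close> is \<open>x_1\<close> or \<open>x_2\<close> times one of order at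
  least \<open>k\<close>, and both factors are carried back by \<open>N\<close>.\<close>

lemma ideal_pow_iff:
  fixes p :: "'k::field triple"
  assumes inf: "infinite (UNIV :: 'k set)" and fr: "is_frame M N p"
  shows "f \<in> ideal_pow (point_ideal p) k \<longleftrightarrow> f \<in> Rpolys \<and> lsub M f \<in> ord_ge k"
proof (induction k arbitrary: f)
  case 0
  then show ?case
    using lsub_in_Rpolys[of f M] by (auto simp: ord_ge_def Rpolys_eq)
next
  case (Suc k)
  have MN: "inv3 M N" "inv3 N M" using fr by (auto simp: is_frame_def)
  show ?case
  proof
    assume "f \<in> ideal_pow (point_ideal p) (Suc k)"
    then have "f \<in> ideal_prod (point_ideal p) (ideal_pow (point_ideal p) k)" by simp
    then show "f \<in> Rpolys \<and> lsub M f \<in> ord_ge (Suc k)"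
    proof induction
      case zero
      then show ?case by (auto simp: Rpolys_eq ord_ge_def lsub.hom_zero)
    next
      case (add a b s)
      have a: "a \<in> Rpolys" "lsub M a \<in> ord_ge 1"
        using add.hyps(1) point_ideal_iff[OF inf fr] by auto
      have b: "b \<in> Rpolys" "lsub M b \<in> ord_ge k"
        using add.hyps(2) Suc.IH by auto
      have "a * b + s \<in> Rpolys"
        using Rpolys_mult[OF a(1) b(1)] add.IH supported_add by (auto simp: Rpolys_eq)
      moreover have "lsub M (a * b + s) \<in> ord_ge (Suc k)"
        using ord_ge_add[of "lsub M a * lsub M b" "Suc k" "lsub M s"] ord_ge_mult[OF a(2) b(2)] add.IH
        by (simp add: lsub.hom_add lsub.hom_mult)
      ultimately show ?case by blast
    qed
  next
    assume f: "f \<in> Rpolys \<and> lsub M f \<in> ord_ge (Suc k)"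
    let ?g = "lsub M f"
    have "f = lsub N ?g" using lsub_lsub[of f M N] f MN by simp
    also have "\<dots> = (\<Sum>mon\<in>Poly_Mapping.keys ?g. lsub N (Poly_Mapping.single mon (Poly_Mapping.lookup ?g mon)))"
      unfolding lsub.hom_sum[symmetric] by (rule arg_cong[where f = "lsub N", OF poly_mapping_eq_sum_single])
    also have "\<dots> \<in> ideal_prod (point_ideal p) (ideal_pow (point_ideal p) k)"
    proof (rule ideal_prod_sum)
      fix mon assume "mon \<in> Poly_Mapping.keys ?g"
      then have mon: "mon \<in> tmon" "Suc k \<le> ndeg mon"
        using f by (auto simp: ord_ge_def supported_def)
      then have "Poly_Mapping.lookup mon 1 > 0 \<or> Poly_Mapping.lookup mon 2 > 0"
        by (auto simp: ndeg_def)
      then obtain i where i: "i \<in> {1, 2}" "Poly_Mapping.lookup mon i > 0"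
        by blast
      define mon' where "mon' = mon - Poly_Mapping.single i 1"
      have mon_eq: "mon = Poly_Mapping.single i 1 + mon'"
        unfolding mon'_def using i(2)
        by (intro poly_mapping_eqI) (auto simp: lookup_add lookup_minus lookup_single when_def)
      have mon': "mon' \<in> tmon" "k \<le> ndeg mon'"
        using mon i(1) unfolding mon_eq tmon_add_iff ndeg_add
        by (auto simp: ndeg_def lookup_single when_def split: if_splits)
      let ?x = "Poly_Mapping.single (Poly_Mapping.single i 1) 1 :: 'k mpoly"
      let ?y = "Poly_Mapping.single mon' (Poly_Mapping.lookup ?g mon)"
      have x: "?x \<in> Rpolys" "?x \<in> ord_ge 1"
        using i(1) tmon_single[of i 1]
        by (auto simp: Rpolys_eq ord_ge_def ndeg_def lookup_single when_def intro!: supported_single)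
      have y: "?y \<in> Rpolys" "?y \<in> ord_ge k"
        using mon' by (auto simp: Rpolys_eq ord_ge_def intro!: supported_single)
      have "lsub N ?x \<in> point_ideal p"
        using x lsub_in_Rpolys[OF x(1)] lsub_lsub[OF x(1) MN(2)] by (simp add: point_ideal_iff[OF inf fr])
      moreover have "lsub N ?y \<in> ideal_pow (point_ideal p) k"
        using y lsub_in_Rpolys[OF y(1)] lsub_lsub[OF y(1) MN(2)] by (simp add: Suc.IH)
      moreover have "lsub N (Poly_Mapping.single mon (Poly_Mapping.lookup ?g mon)) = lsub N ?x * lsub N ?y"
        unfolding lsub.hom_mult[symmetric] mult_single mon_eq[symmetric] by simp
      ultimately show "\<exists>a\<in>point_ideal p. \<exists>b\<in>ideal_pow (point_ideal p) k.
          lsub N (Poly_Mapping.single mon (Poly_Mapping.lookup ?g mon)) = a * b" by blast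
    qed simp
    finally show "f \<in> ideal_pow (point_ideal p) (Suc k)" by simp
  qed
qed

section \<open>Multiplication by a line and the residual scheme\<close>

lemma linform_unit:
  assumes "k < 3" "\<And>j. j < 3 \<Longrightarrow> r j = (if j = k then c else 0)"
  shows "linform r = Poly_Mapping.single (Poly_Mapping.single k 1) c"
proof -
  have "linform r = (\<Sum>j<3. if j = k then Poly_Mapping.single (Poly_Mapping.single k 1) c else 0)"
    unfolding linform_def using assms(2) by (intro sum.cong) auto
  then show ?thesis using assms(1) by simp
qed

text \<open>In an adapted frame \<open>L\<close> is \<open>x_1\<close> if it passes through
  \<open>p\<close>, which raises the order by exactly one, and otherwise a nonzero multiple of
  \<open>x_0\<close>, which leaves the order unchanged.\<close>

lemma linform_mult_in_ideal_pow_iff: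
  fixes p :: "'k::field triple"
  assumes inf: "infinite (UNIV :: 'k set)" and p: "p \<noteq> (0, 0, 0)" and L: "L \<noteq> (0, 0, 0)"
    and g: "g \<in> Rpolys"
  shows "linform (coord L) * g \<in> ideal_pow (point_ideal p) k
    \<longleftrightarrow> g \<in> ideal_pow (point_ideal p) (if on_line L p then k - 1 else k)"
proof -
  have R: "linform (coord L) * g \<in> Rpolys" by (intro Rpolys_mult linform_in_Rpolys g)
  show ?thesis
  proof (cases "on_line L p")
    case True
    obtain M N where fr: "is_frame M N p"
      and LM: "\<And>j. j < 3 \<Longrightarrow> (\<Sum>i<3. coord L i * M i j) = (if j = 1 then 1 else 0)"
      using frame_on_line[OF p L True] by blast
    have Mg: "lsub M g \<in> supported tmon" using lsub_in_Rpolys[OF g] by (simp add: Rpolys_eq)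
    have "lsub M (linform (coord L) * g) = Poly_Mapping.single (Poly_Mapping.single 1 1) 1 * lsub M g"
      unfolding lsub.hom_mult lsub_linform using LM by (subst linform_unit[of 1 _ 1]) auto
    also have "\<dots> \<in> ord_ge k \<longleftrightarrow> lsub M g \<in> ord_ge (k - 1)"
      unfolding ord_ge_def
      by (rule supported_mult_single_iff[OF _ Mg])
         (auto simp: tmon_add_iff tmon_single ndeg_def lookup_single lookup_add when_def)
    finally show ?thesis
      using True R g by (simp add: ideal_pow_iff[OF inf fr])
  next
    case False
    obtain M N where fr: "is_frame M N p"
      and LM: "\<And>j. j < 3 \<Longrightarrow> (\<Sum>i<3. coord L i * M i j) = (if j = 0 then ldot L p else 0)"
      using frame_off_line[OF False] by blast
    have Mg: "lsub M g \<in> supported tmon" using lsub_in_Rpolys[OF g] by (simp add: Rpolys_eq)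
    have "lsub M (linform (coord L) * g) = Poly_Mapping.single (Poly_Mapping.single 0 1) (ldot L p) * lsub M g"
      unfolding lsub.hom_mult lsub_linform using LM by (subst linform_unit[of 0 _ "ldot L p"]) auto
    also have "\<dots> \<in> ord_ge k \<longleftrightarrow> lsub M g \<in> ord_ge k"
      unfolding ord_ge_def
      by (rule supported_mult_single_iff[OF _ Mg])
         (use False in \<open>auto simp: on_line_iff_ldot tmon_add_iff tmon_single ndeg_def lookup_single lookup_add when_def\<close>)
    finally show ?thesis
      using False R g by (simp add: ideal_pow_iff[OF inf fr])
  qed
qed

text \<open>Point by point, the ideal quotient of I_A by \<open>L\<close> is the ideal of the
  residual.\<close>

lemma linform_mult_in_fat_ideal_iff:
  fixes P :: "'k::field triple set"
  assumes "infinite (UNIV :: 'k set)" "(0, 0, 0) \<notin> P" "L \<noteq> (0, 0, 0)" "g \<in> Rpolys"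
  shows "linform (coord L) * g \<in> fat_ideal P m \<longleftrightarrow> g \<in> fat_ideal P (residual L m)"
proof -
  have "linform (coord L) * g \<in> Rpolys" by (intro Rpolys_mult linform_in_Rpolys assms)
  moreover have "linform (coord L) * g \<in> ideal_pow (point_ideal p) (m p)
      \<longleftrightarrow> g \<in> ideal_pow (point_ideal p) (residual L m p)" if "p \<in> P" for p
  proof -
    have "p \<noteq> (0, 0, 0)" using that assms(2) by auto
    then show ?thesis
      using linform_mult_in_ideal_pow_iff[OF assms(1) _ assms(3,4), of p "m p"] by (simp add: residual_def)
  qed
  ultimately show ?thesis
    using assms(4) by (auto simp: fat_ideal_def)
qed

section \<open>Lower bound\<close>

lemma lookup_pscale: "Poly_Mapping.lookup (pscale c f) mon = c * Poly_Mapping.lookup f mon"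
  using lookup_mult_single[of 0 c f mon] by (simp add: pscale_def)

interpretation mp: vector_space "pscale :: 'k::field \<Rightarrow> 'k mpoly \<Rightarrow> 'k mpoly"
  by unfold_locales (auto intro!: poly_mapping_eqI simp: lookup_pscale lookup_add algebra_simps)

lemma subspace_supported: "mp.subspace (supported S :: 'k::field mpoly set)"
  unfolding mp.subspace_def
  by (auto simp: supported_add const_mult_supported pscale_def)

lemma supported_in_span:
  assumes "f \<in> supported S"
  shows "f \<in> mp.span ((\<lambda>mon. Poly_Mapping.single mon 1) ` S)"
proof -
  have "(\<Sum>k\<in>Poly_Mapping.keys f. pscale (Poly_Mapping.lookup f k) (Poly_Mapping.single k 1))
      \<in> mp.span ((\<lambda>mon. Poly_Mapping.single mon 1) ` S)"
    by (intro mp.span_sum mp.span_scale mp.span_base) (use assms in \<open>auto simp: supported_def\<close>)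
  then show ?thesis
    using poly_mapping_eq_sum_single[of f] by (simp add: pscale_def mult_single)
qed

lemma dim_supported:
  assumes "finite S"
  shows "mp.dim (supported S :: 'k::field mpoly set) = card S"
proof (rule mp.dim_unique)
  let ?B = "(\<lambda>mon. Poly_Mapping.single mon (1::'k)) ` S"
  have inj: "inj_on (\<lambda>mon. Poly_Mapping.single mon (1::'k)) S"
    by (rule inj_onI) (metis keys_single singleton_inject zero_neq_one)
  show "?B \<subseteq> supported S" by (auto intro: supported_single)
  show "supported S \<subseteq> mp.span ?B" using supported_in_span by blast
  show "card ?B = card S" by (rule card_image[OF inj])
  show "mp.independent ?B"
  proof (rule mp.independent_if_scalars_zero)
    show "finite ?B" using assms by simp
    fix u :: "'k mpoly \<Rightarrow> 'k" and b
    assume 0: "(\<Sum>x\<in>?B. pscale (u x) x) = 0" and "b \<in> ?B"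
    then obtain k where k: "k \<in> S" "b = Poly_Mapping.single k 1" by blast
    have "0 = Poly_Mapping.lookup (\<Sum>x\<in>?B. pscale (u x) x) k" by (simp only: 0 lookup_zero)
    also have "\<dots> = (\<Sum>mon\<in>S. if mon = k then u b else 0)"
      by (auto simp: k(2) sum.reindex[OF inj] lookup_sum lookup_pscale lookup_single when_def intro!: sum.cong)
    also have "\<dots> = u b" using k assms by simp
    finally show "u b = 0" by simp
  qed
qed

text \<open>Exponents of \<open>x_1\<close> and \<open>x_2\<close>. With \<open>k = t + 1\<close>
  they index the monomials of degree \<open>t\<close>, with \<open>k = m p\<close> the conditions
  that a point of multiplicity \<open>m p\<close> imposes.\<close>

definition pairs_lt :: "nat \<Rightarrow> (nat \<times> nat) set" where
  "pairs_lt k = {(a, b). a + b < k}"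

lemma pairs_lt_Suc: "pairs_lt (Suc k) = pairs_lt k \<union> (\<lambda>a. (a, k - a)) ` {..k}"
  by (auto simp: pairs_lt_def image_iff)

lemma card_pairs_lt: "finite (pairs_lt k) \<and> card (pairs_lt k) = Suc k choose 2"
proof (induction k)
  case 0
  then show ?case by (simp add: pairs_lt_def)
next
  case (Suc k)
  have "card ((\<lambda>a. (a, k - a)) ` {..k}) = Suc k"
    by (subst card_image) (auto intro: inj_onI)
  moreover have "pairs_lt k \<inter> (\<lambda>a. (a, k - a)) ` {..k} = {}"
    by (auto simp: pairs_lt_def)
  ultimately show ?case
    using Suc by (simp add: pairs_lt_Suc card_Un_disjoint numeral_2_eq_2)
qed

text \<open>The exponent of \<open>x_0\<close> fills up to degree \<open>t\<close>. If
  \<open>a + b > t\<close>, the subtraction stops at 0 and the monomial has degree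
  \<open>a + b\<close>, so its coefficient in a form of degree \<open>t\<close> is 0 anyway.\<close>

definition deg_mon :: "nat \<Rightarrow> nat \<times> nat \<Rightarrow> (nat \<Rightarrow>\<^sub>0 nat)" where
  "deg_mon t = (\<lambda>(a, b). Poly_Mapping.single 0 (t - a - b) + Poly_Mapping.single 1 a + Poly_Mapping.single 2 b)"

lemma deg_mon_eq:
  assumes "mon \<in> tmon" "tdeg mon = t"
  shows "deg_mon t (Poly_Mapping.lookup mon 1, Poly_Mapping.lookup mon 2) = mon"
proof -
  have "t - Poly_Mapping.lookup mon 1 - Poly_Mapping.lookup mon 2 = Poly_Mapping.lookup mon 0"
    using assms(2) by (simp add: tdeg_def)
  then show ?thesis using tmon_eq[OF assms(1)] by (simp add: deg_mon_def)
qed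

lemma bij_deg_mon: "bij_betw (deg_mon t) (pairs_lt (Suc t)) {mon\<in>tmon. tdeg mon = t}"
proof (rule bij_betw_byWitness[where f' = "\<lambda>mon. (Poly_Mapping.lookup mon 1, Poly_Mapping.lookup mon 2)"])
  show "(\<lambda>mon. (Poly_Mapping.lookup mon 1, Poly_Mapping.lookup mon 2)) ` {mon\<in>tmon. tdeg mon = t}
      \<subseteq> pairs_lt (Suc t)"
    by (auto simp: pairs_lt_def tdeg_def)
  show "deg_mon t ` pairs_lt (Suc t) \<subseteq> {mon\<in>tmon. tdeg mon = t}"
    by (auto simp: pairs_lt_def deg_mon_def tmon_add_iff tmon_single tdeg_def lookup_add lookup_single when_def)
qed (auto simp: deg_mon_eq[simplified], auto simp: deg_mon_def lookup_add lookup_single when_def)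

lemma finite_deg_mons: "finite {mon\<in>tmon. tdeg mon = t}"
  using bij_deg_mon card_pairs_lt bij_betw_finite by blast

lemma kdim_forms_deg: "kdim (forms_deg t :: 'k::field mpoly set) = (t + 2) choose 2"
  using dim_supported[where 'k = 'k, OF finite_deg_mons[of t]] bij_betw_same_card[OF bij_deg_mon] card_pairs_lt[of "Suc t"]
  by (simp add: kdim_def forms_deg_eq)

abbreviation deg_basis :: "nat \<Rightarrow> 'k::field mpoly set" where
  "deg_basis t \<equiv> (\<lambda>mon. Poly_Mapping.single mon 1) ` {mon\<in>tmon. tdeg mon = t}"

lemma forms_deg_subset_span: "forms_deg t \<subseteq> mp.span (deg_basis t)"
  unfolding forms_deg_eq using supported_in_span by blast

lemma lsub_pscale: "lsub M (pscale c f) = pscale c (lsub M f)"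
proof -
  have "lsub M (Poly_Mapping.single 0 c) = Poly_Mapping.single 0 c"
    by (simp add: lsub_def unital_hom.psubst_single[OF unital_hom_single])
  then show ?thesis by (simp add: pscale_def lsub.hom_mult)
qed

lemma subspace_ideal_pow:
  fixes p :: "'k::field triple"
  assumes "infinite (UNIV :: 'k set)" "p \<noteq> (0, 0, 0)"
  shows "mp.subspace (ideal_pow (point_ideal p) k)"
proof -
  obtain M N where fr: "is_frame M N p" using frame_exists[OF assms(2)] by blast
  show ?thesis
    using subspace_supported[where 'k = 'k, of tmon]
      subspace_supported[where 'k = 'k, of "{mon\<in>tmon. k \<le> ndeg mon}"]
    by (auto simp: mp.subspace_def ideal_pow_iff[OF assms(1) fr] Rpolys_eq ord_ge_def
        lsub.hom_add lsub.hom_zero lsub_pscale)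
qed

lemma subspace_fat_ideal_forms:
  fixes P :: "'k::field triple set"
  assumes "infinite (UNIV :: 'k set)" "(0, 0, 0) \<notin> P"
  shows "mp.subspace (fat_ideal P m \<inter> forms_deg t)"
proof -
  have "mp.subspace (ideal_pow (point_ideal p) (m p))" if "p \<in> P" for p
    using subspace_ideal_pow[OF assms(1)] that assms(2) by metis
  then show ?thesis
    unfolding fat_ideal_def Rpolys_eq forms_deg_eq
    by (intro mp.subspace_inter subspace_supported mp.subspace_Int) auto
qed

text \<open>In a frame at \<open>p\<close>, a form lies in the \<open>m p\<close>-th power of the
  ideal of \<open>p\<close> if its coefficients at all monomials of order below \<open>m p\<close>
  vanish. These coefficients are the functionals \<open>\<phi>\<close>.\<close>

lemma forms_dim_le_fat_ideal_dim:
  fixes P :: "'k::field triple set"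
  assumes inf: "infinite (UNIV :: 'k set)" and P: "finite P" "(0, 0, 0) \<notin> P"
  shows "(t + 2) choose 2 \<le> fat_ideal_dim P m t + (\<Sum>p\<in>P. (m p + 1) choose 2)"
proof -
  have "\<exists>M N. is_frame M N p" if "p \<in> P" for p
    using frame_exists[of p] P(2) that by metis
  then obtain M where M: "\<And>p. p \<in> P \<Longrightarrow> \<exists>N. is_frame (M p) N p" by metis
  define I where "I = (SIGMA p:P. pairs_lt (m p))"
  define \<phi> where "\<phi> = (\<lambda>(p, ab) f. Poly_Mapping.lookup (lsub (M p) f) (deg_mon t ab))"
  have I: "finite I" "card I = (\<Sum>p\<in>P. (m p + 1) choose 2)"
    using P(1) card_pairs_lt by (auto simp: I_def)
  have "mp.dim (forms_deg t :: 'k mpoly set)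
      \<le> mp.dim {f\<in>forms_deg t. \<forall>i\<in>I. \<phi> i f = 0} + card I"
  proof (rule mp.dim_le_kers_add_card[OF I(1) _ forms_deg_subset_span])
    show "mp.subspace (forms_deg t)" unfolding forms_deg_eq by (rule subspace_supported)
  qed (auto simp: \<phi>_def finite_deg_mons lsub.hom_add lsub_pscale lookup_pscale lookup_add split: prod.splits)
  also have "mp.dim {f\<in>forms_deg t. \<forall>i\<in>I. \<phi> i f = 0} \<le> mp.dim (fat_ideal P m \<inter> forms_deg t)"
  proof (rule mp.dim_subset_finite_span)
    show "{f\<in>forms_deg t. \<forall>i\<in>I. \<phi> i f = 0} \<subseteq> fat_ideal P m \<inter> forms_deg t"
    proof safe
      fix f :: "'k mpoly" assume f: "f \<in> forms_deg t" and 0: "\<forall>i\<in>I. \<phi> i f = 0"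
      have fR: "f \<in> Rpolys" using f forms_deg_subset_Rpolys by blast
      have "f \<in> ideal_pow (point_ideal p) (m p)" if p: "p \<in> P" for p
      proof -
        obtain N where fr: "is_frame (M p) N p" using M[OF p] by blast
        have Mf: "lsub (M p) f \<in> supported {mon\<in>tmon. tdeg mon = t}"
          using lsub_in_forms_deg[OF f] by (simp add: forms_deg_eq)
        have "m p \<le> ndeg mon" if mon: "mon \<in> Poly_Mapping.keys (lsub (M p) f)" for mon
        proof (rule ccontr)
          assume "\<not> m p \<le> ndeg mon"
          then have "(p, Poly_Mapping.lookup mon 1, Poly_Mapping.lookup mon 2) \<in> I"
            using p by (simp add: I_def pairs_lt_def ndeg_def)
          then have "\<phi> (p, Poly_Mapping.lookup mon 1, Poly_Mapping.lookup mon 2) f = 0"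
            using 0 by blast
          moreover have "mon \<in> tmon" "tdeg mon = t" using mon Mf by (auto simp: supported_def)
          ultimately show False using mon by (simp add: \<phi>_def deg_mon_eq[simplified] in_keys_iff)
        qed
        then have "lsub (M p) f \<in> ord_ge (m p)"
          using Mf by (auto simp: ord_ge_def supported_def)
        then show ?thesis using fR by (simp add: ideal_pow_iff[OF inf fr])
      qed
      then show "f \<in> fat_ideal P m" using fR by (simp add: fat_ideal_def)
    qed
    show "fat_ideal P m \<inter> forms_deg t \<subseteq> mp.span (deg_basis t)"
      using forms_deg_subset_span by blast
  qed (simp add: finite_deg_mons)
  finally show ?thesis
    using kdim_forms_deg[where 'k = 'k] by (simp add: I(2) fat_ideal_dim_def kdim_def)
qed

section \<open>Embedding the ideals of the residuals\<close>

lemma linform_coord_nonzero: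
  assumes "L \<noteq> (0, 0, 0)"
  shows "linform (coord L) \<noteq> 0"
proof
  assume 0: "linform (coord L) = 0"
  have "coord L j = 0" if "j < 3" for j
  proof -
    have "Poly_Mapping.lookup (linform (coord L)) (Poly_Mapping.single j 1)
        = (\<Sum>i<3. if i = j then coord L j else 0)"
      unfolding linform_def lookup_sum
      by (intro sum.cong) (auto simp: lookup_single when_def dest!: arg_cong[where f = Poly_Mapping.keys])
    also have "\<dots> = coord L j" using that by simp
    finally show ?thesis by (simp add: 0)
  qed
  from this[of 0] this[of 1] this[of 2] assms show False
    by (cases L) (auto simp: coord_def)
qed

lemma dim_linform_mult_image:
  assumes "L \<noteq> (0, 0, 0)"
  shows "mp.dim ((*) (linform (coord L)) ` V) = mp.dim V"
proof (rule mp.dim_image_linear_inj)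
  show "Vector_Spaces.linear pscale pscale ((*) (linform (coord L)))"
    by unfold_locales (auto simp: pscale_def algebra_simps)
  show "inj ((*) (linform (coord L)))"
    using linform_coord_nonzero[OF assms] by (auto intro: injI)
qed

lemma linform_mult_image_subset:
  fixes P :: "'k::field triple set"
  assumes "infinite (UNIV :: 'k set)" "(0, 0, 0) \<notin> P" "L \<noteq> (0, 0, 0)"
  shows "(*) (linform (coord L)) ` (fat_ideal P (residual L m) \<inter> forms_deg t)
    \<subseteq> fat_ideal P m \<inter> forms_deg (Suc t)"
proof safe
  fix g :: "'k mpoly" assume g: "g \<in> fat_ideal P (residual L m)" "g \<in> forms_deg t"
  then show "linform (coord L) * g \<in> fat_ideal P m"
    using linform_mult_in_fat_ideal_iff[OF assms] forms_deg_subset_Rpolys by blast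
  show "linform (coord L) * g \<in> forms_deg (Suc t)"
    using forms_deg_mult[OF linform_in_forms_deg g(2)] by simp
qed

lemma fat_ideal_dim_residual_le:
  fixes P :: "'k::field triple set"
  assumes "infinite (UNIV :: 'k set)" "(0, 0, 0) \<notin> P" "L \<noteq> (0, 0, 0)"
  shows "fat_ideal_dim P (residual L m) t \<le> fat_ideal_dim P m (Suc t)"
proof -
  have "mp.dim ((*) (linform (coord L)) ` (fat_ideal P (residual L m) \<inter> forms_deg t))
      \<le> mp.dim (fat_ideal P m \<inter> forms_deg (Suc t))"
    using linform_mult_image_subset[OF assms] forms_deg_subset_span[of "Suc t"] finite_deg_mons
    by (intro mp.dim_subset_finite_span[where B = "deg_basis (Suc t)"]) auto
  then show ?thesis
    by (simp add: fat_ideal_dim_def kdim_def dim_linform_mult_image[OF assms(3)])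
qed

lemma fat_ideal_dim_res_seq_le:
  fixes P :: "'k::field triple set"
  assumes "infinite (UNIV :: 'k set)" "(0, 0, 0) \<notin> P" "\<And>j. j \<in> {1..i} \<Longrightarrow> L j \<noteq> (0, 0, 0)"
  shows "fat_ideal_dim P (res_seq m L i) t \<le> fat_ideal_dim P m (t + i)"
  using assms(3)
proof (induction i arbitrary: t)
  case (Suc i)
  have "fat_ideal_dim P (res_seq m L (Suc i)) t \<le> fat_ideal_dim P (res_seq m L i) (Suc t)"
    using fat_ideal_dim_residual_le[OF assms(1,2)] Suc.prems[of "Suc i"] by simp
  also have "\<dots> \<le> fat_ideal_dim P m (Suc t + i)"
    by (rule Suc.IH) (use Suc.prems in auto)
  finally show ?case by simp
qed simp

text \<open>At each point on \<open>L\<close>, \<open>(m + 1) choose 2\<close> exceeds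
  \<open>m choose 2\<close> by \<open>m\<close>: passing to the residual lowers the degree by the
  entry of the reduction vector.\<close>

lemma degree_residual:
  assumes "finite P"
  shows "(\<Sum>p\<in>P. (m p + 1) choose 2)
    = (\<Sum>p\<in>{p\<in>P. on_line L p}. m p) + (\<Sum>p\<in>P. (residual L m p + 1) choose 2)"
proof -
  have "(m p + 1) choose 2 = (if on_line L p then m p else 0) + ((residual L m p + 1) choose 2)" for p
    by (cases "m p") (auto simp: residual_def numeral_2_eq_2)
  then show ?thesis
    using assms by (simp add: sum.distrib sum.If_cases Int_def)
qed

text \<open>Downward from \<open>i = n + 1\<close>, where total reduction leaves degree 0.\<close>

lemma degree_res_seq:
  assumes "finite P" "\<And>p. p \<in> P \<Longrightarrow> res_seq m L (n + 1) p = 0" "i \<le> n + 1"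
  shows "(\<Sum>p\<in>P. (res_seq m L i p + 1) choose 2) = (\<Sum>j=i+1..n+1. red_vec P m L j)"
  using assms(3)
proof (induction i rule: inc_induct)
  case base
  then show ?case using assms(2) by (simp add: sum.neutral)
next
  case (step i)
  have "{i+1..n+1} = insert (i+1) {Suc i + 1..n+1}" using step.hyps by auto
  then show ?case
    using degree_residual[OF assms(1), of "res_seq m L i" "L (Suc i)"] step.IH
    by (simp add: red_vec_def)
qed

lemma hcand_le_fat_ideal_dim:
  fixes P :: "'k::field triple set"
  assumes inf: "infinite (UNIV :: 'k set)" and P: "fat_point_support P"
    and tr: "totally_reduces P m L n" and i: "i \<le> n + 1"
  shows "hcand n t (red_vec P m L) i \<le> int (fat_ideal_dim P m t)"
proof (cases "i \<le> t")
  case True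
  have P': "finite P" "(0, 0, 0) \<notin> P" using P by (auto simp: fat_point_support_def)
  have "(t - i + 2) choose 2 \<le> fat_ideal_dim P (res_seq m L i) (t - i) + (\<Sum>j=i+1..n+1. red_vec P m L j)"
    using forms_dim_le_fat_ideal_dim[OF inf P', of "t - i" "res_seq m L i"]
      degree_res_seq[OF P'(1) _ i, of m L] tr by (simp add: totally_reduces_def)
  also have "fat_ideal_dim P (res_seq m L i) (t - i) \<le> fat_ideal_dim P m (t - i + i)"
    by (rule fat_ideal_dim_res_seq_le[OF inf P'(2)]) (use tr i in \<open>auto simp: totally_reduces_def\<close>)
  finally have "(t - i + 2) choose 2 \<le> fat_ideal_dim P m t + (\<Sum>j=i+1..n+1. red_vec P m L j)"
    using True by simp
  then have "int ((t - i + 2) choose 2)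
      \<le> int (fat_ideal_dim P m t + (\<Sum>j=i+1..n+1. red_vec P m L j))"
    by (simp only: of_nat_le_iff)
  moreover have "bnm (int t - int i + 2) 2 = int ((t - i + 2) choose 2)"
  proof -
    have e: "int t - int i + 2 = int (t - i + 2)" using True by simp
    show ?thesis unfolding e bnm_def nat_int by simp
  qed
  ultimately show ?thesis by (simp add: hcand_def del: sum.cl_ivl_Suc)
next
  case False
  \<comment> \<open>For \<open>i > t\<close> the binomial has argument at most 1 and is 0.\<close>
  then have "hcand n t (red_vec P m L) i \<le> 0"
    by (simp add: hcand_def bnm_def sum_nonneg)
  then show ?thesis by simp
qed

section \<open>Restriction to a line and upper bound\<close>

lemma triple_eqI:
  assumes "\<And>i. i < 3 \<Longrightarrow> coord p i = coord q i"
  shows "p = q"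
  using assms[of 0] assms[of 1] assms[of 2] by (cases p; cases q) (simp add: coord_def)

lemma coord_smult3: "coord (smult3 c p) i = c * coord p i"
  by (auto simp: coord_def smult3_def split: prod.splits)

text \<open>\<open>L M\<close> is the unit row of index 1, so \<open>L\<close> is row 1 of the
  inverse. Hence the frame coordinate of index 1 of a point is the value of \<open>L\<close>
  there.\<close>

lemma frame_row_eq_line:
  assumes "inv3 M N" "\<And>j. j < 3 \<Longrightarrow> (\<Sum>i<3. coord L i * M i j) = (if j = 1 then 1 else 0)" "k < 3"
  shows "N 1 k = coord L k"
proof -
  have "N 1 k = (\<Sum>j<3. (if j = 1 then 1 else 0) * N j k)"
    by (simp add: sum_lessThan_3)
  also have "\<dots> = (\<Sum>j<3. (\<Sum>i<3. coord L i * M i j) * N j k)"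
    using assms(2) by (intro sum.cong) auto
  also have "\<dots> = (\<Sum>i<3. coord L i * (\<Sum>j<3. M i j * N j k))"
    by (simp add: sum_lessThan_3 algebra_simps)
  also have "\<dots> = (\<Sum>i<3. coord L i * (if i = k then 1 else 0))"
    using assms(1,3) by (intro sum.cong) (auto simp: inv3_def)
  also have "\<dots> = coord L k"
    using assms(3) by (auto simp: sum_lessThan_3 numeral_3_eq_3 less_Suc_eq numeral_2_eq_2)
  finally show ?thesis .
qed

lemma inv3_apply:
  assumes "inv3 M N" "i < 3"
  shows "x i = (\<Sum>j<3. M i j * (\<Sum>k<3. N j k * x k))"
proof -
  have "(\<Sum>j<3. M i j * (\<Sum>k<3. N j k * x k)) = (\<Sum>k<3. (\<Sum>j<3. M i j * N j k) * x k)"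
    by (simp add: sum_lessThan_3 algebra_simps)
  also have "\<dots> = (\<Sum>k<3. (if i = k then 1 else 0) * x k)"
    using assms by (intro sum.cong) (auto simp: inv3_def)
  also have "\<dots> = x i"
    using assms(2) by (auto simp: sum_lessThan_3 numeral_3_eq_3 less_Suc_eq numeral_2_eq_2)
  finally show ?thesis by simp
qed

text \<open>With \<open>a\<close> and \<open>v\<close> the columns 0 and 2 of a frame,
  \<open>b = v + \<theta> a\<close> lies on \<open>L\<close> for every \<open>\<theta>\<close>. It
  can be proportional to a point \<open>p\<close> only if \<open>\<theta>\<close> is the ratio of
  the frame coordinates 0 and 2 of \<open>p\<close>, which excludes finitely many values.\<close>

lemma point_on_line_avoiding:
  fixes P :: "'k::field triple set"
  assumes inf: "infinite (UNIV :: 'k set)" and P: "finite P" and L: "L \<noteq> (0, 0, 0)"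
  obtains b where "b \<noteq> (0, 0, 0)" "on_line L b" "\<forall>p\<in>P. \<forall>c. b \<noteq> smult3 c p"
proof -
  obtain x y z where Lx: "L = (x, y, z)" by (metis prod.exhaust)
  have "\<exists>a. a \<noteq> (0, 0, 0) \<and> on_line L a"
  proof (cases "x = 0 \<and> y = 0")
    case True
    then show ?thesis by (intro exI[of _ "(1, 0, 0)"]) (simp add: Lx on_line_def)
  next
    case False
    then show ?thesis by (intro exI[of _ "(y, -x, 0)"]) (auto simp: Lx on_line_def)
  qed
  then obtain a where a: "a \<noteq> (0, 0, 0)" "on_line L a" by blast
  obtain M N where fr: "is_frame M N a"
    and LM: "\<And>j. j < 3 \<Longrightarrow> (\<Sum>i<3. coord L i * M i j) = (if j = 1 then 1 else 0)"
    using frame_on_line[OF a(1) L a(2)] by blast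
  define n where "n j p = (\<Sum>k<3. N j k * coord p k)" for j p
  have "finite ((\<lambda>p. n 0 p / n 2 p) ` P)" using P by simp
  then obtain \<theta> where \<theta>: "\<theta> \<notin> (\<lambda>p. n 0 p / n 2 p) ` P"
    using ex_new_if_finite[OF inf] by blast
  define b where "b = (M 0 2 + \<theta> * M 0 0, M 1 2 + \<theta> * M 1 0, M 2 2 + \<theta> * M 2 0)"
  have cb: "coord b i = M i 2 + \<theta> * M i 0" if "i < 3" for i
    using that by (auto simp: b_def coord_def numeral_3_eq_3 less_Suc_eq numeral_2_eq_2)
  have NM: "(\<Sum>k<3. N j k * M k i) = (if j = i then 1 else 0)" if "j < 3" "i < 3" for i j
    using fr that by (auto simp: is_frame_def inv3_def)
  have nb: "n j b = (\<Sum>k<3. N j k * M k 2) + \<theta> * (\<Sum>k<3. N j k * M k 0)" for j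
    by (simp add: n_def cb sum.distrib sum_distrib_left algebra_simps)
  have n2: "n 2 b = 1" and n0: "n 0 b = \<theta>"
    by (simp_all add: nb NM)
  show ?thesis
  proof (rule that[of b])
    show "b \<noteq> (0, 0, 0)"
    proof
      assume b0: "b = (0, 0, 0)"
      have "n 2 b = 0" unfolding n_def b0 by (simp add: coord_def sum.neutral)
      with n2 show False by simp
    qed
    have "ldot L b = (\<Sum>i<3. coord L i * M i 2) + \<theta> * (\<Sum>i<3. coord L i * M i 0)"
      by (simp add: ldot_def cb sum.distrib sum_distrib_left algebra_simps)
    then show "on_line L b" by (simp add: on_line_iff_ldot LM)
    show "\<forall>p\<in>P. \<forall>c. b \<noteq> smult3 c p"
    proof (intro ballI allI notI)
      fix p c assume p: "p \<in> P" and b: "b = smult3 c p"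
      have s: "n j b = c * n j p" for j
        by (simp add: n_def b coord_smult3 sum_distrib_left mult_ac)
      have "c * n 2 p = 1" "\<theta> = c * n 0 p" using n2 n0 s by auto
      then have "\<theta> = n 0 p / n 2 p" by (auto simp: divide_simps)
      with \<theta> p show False by blast
    qed
  qed
qed

text \<open>The line is parametrised by \<open>\<beta> \<mapsto> v + \<beta> b\<close>, where \<open>b\<close> and \<open>v\<close> are the columns 0 and 2 of the
  frame; \<open>b\<close> will lie outside the support, so that no point of the scheme is at \<open>\<beta> = \<infinity>\<close>.\<close>

definition line_restr :: "(nat \<Rightarrow> nat \<Rightarrow> 'k::field) \<Rightarrow> 'k mpoly \<Rightarrow> 'k poly" where
  "line_restr M = psubst (\<lambda>c. [:c:]) (\<lambda>i. [:M i 2, M i 0:])"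

lemma monv_tmon:
  assumes "mon \<in> tmon"
  shows "monv x mon = x 0 ^ Poly_Mapping.lookup mon 0 * x 1 ^ Poly_Mapping.lookup mon 1
    * x 2 ^ Poly_Mapping.lookup mon 2"
  by (subst tmon_eq[OF assms]) (simp add: monv_add)

lemma degree_line_restr_le:
  assumes "f \<in> forms_deg t"
  shows "degree (line_restr M f) \<le> t"
  unfolding line_restr_def psubst_def
proof (rule degree_sum_le)
  fix mon assume "mon \<in> Poly_Mapping.keys f"
  then have mon: "mon \<in> tmon" "tdeg mon = t" using assms by (auto simp: forms_deg_eq supported_def)
  have pw: "degree ([:M i 2, M i 0:] ^ k) \<le> k" for i k
    using degree_power_le[of "[:M i 2, M i 0:]" k] by (rule order_trans) simp
  have "degree (monv (\<lambda>i. [:M i 2, M i 0:]) mon) \<le> Poly_Mapping.lookup mon 0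
      + Poly_Mapping.lookup mon 1 + Poly_Mapping.lookup mon 2"
    unfolding monv_tmon[OF mon(1)]
    by (intro degree_mult_le[THEN order_trans] add_mono pw)
  then show "degree ([:Poly_Mapping.lookup f mon:] * monv (\<lambda>i. [:M i 2, M i 0:]) mon) \<le> t"
    using mon(2) degree_smult_le[of "Poly_Mapping.lookup f mon" "monv (\<lambda>i. [:M i 2, M i 0:]) mon"]
    by (simp add: tdeg_def)
qed simp

text \<open>In a frame at \<open>p\<close> every monomial of \<open>f\<close> has at least
  \<open>k\<close> factors \<open>x_1\<close> or \<open>x_2\<close>. On the line these become the
  polynomials \<open>z 1\<close> and \<open>z 2\<close> in the parameter, both zero at
  \<open>\<beta>\<close>, because the point there is proportional to \<open>p\<close>.\<close>

lemma line_restr_dvd: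
  fixes p :: "'k::field triple"
  assumes inf: "infinite (UNIV :: 'k set)" and p: "p \<noteq> (0, 0, 0)"
    and f: "f \<in> ideal_pow (point_ideal p) k"
    and s: "s \<noteq> 0" "\<And>i. i < 3 \<Longrightarrow> coord p i = s * (M i 2 + \<beta> * M i 0)"
  shows "[:- \<beta>, 1:] ^ k dvd line_restr M f"
proof -
  obtain M' N' where fr: "is_frame M' N' p" using frame_exists[OF p] by blast
  let ?g = "lsub M' f"
  have g: "f \<in> Rpolys" "?g \<in> ord_ge k" using f by (auto simp: ideal_pow_iff[OF inf fr])
  define z where "z j = (\<Sum>i<3. [:N' j i:] * [:M i 2, M i 0:])" for j
  have Ng: "lsub N' ?g = f" using lsub_lsub[OF g(1), of M' N'] fr by (simp add: is_frame_def)
  have "line_restr M (lsub N' ?g) = psubst (\<lambda>c. [:c:]) z ?g"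
    unfolding line_restr_def z_def by (rule unital_hom.psubst_lsub[OF unital_hom_const_poly])
  then have restr: "line_restr M f = psubst (\<lambda>c. [:c:]) z ?g"
    by (simp only: Ng)
  have dvd: "[:- \<beta>, 1:] dvd z j" if j: "j < 3" "j \<noteq> 0" for j
  proof -
    have "s * poly (z j) \<beta> = (\<Sum>i<3. N' j i * (s * (M i 2 + \<beta> * M i 0)))"
      by (simp add: z_def poly_sum sum_distrib_left algebra_simps)
    also have "\<dots> = (\<Sum>i<3. N' j i * M' i 0)"
      using s(2) fr by (intro sum.cong) (auto simp: is_frame_def)
    also have "\<dots> = 0"
    proof -
      have "inv3 N' M'" using fr by (simp add: is_frame_def)
      then show ?thesis using j by (simp add: inv3_def)
    qed
    finally show ?thesis using s(1) by (simp add: poly_eq_0_iff_dvd)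
  qed
  show ?thesis
    unfolding restr psubst_def
  proof (intro dvd_sum dvd_mult)
    fix mon assume "mon \<in> Poly_Mapping.keys ?g"
    then have mon: "mon \<in> tmon" "k \<le> ndeg mon" using g(2) by (auto simp: ord_ge_def supported_def)
    have "[:- \<beta>, 1:] ^ Poly_Mapping.lookup mon 1 * [:- \<beta>, 1:] ^ Poly_Mapping.lookup mon 2
        dvd z 1 ^ Poly_Mapping.lookup mon 1 * z 2 ^ Poly_Mapping.lookup mon 2"
      by (intro mult_dvd_mono dvd_power_same dvd) auto
    then have "[:- \<beta>, 1:] ^ ndeg mon dvd monv z mon"
      unfolding monv_tmon[OF mon(1)] ndeg_def power_add mult.assoc by (rule dvd_mult)
    then show "[:- \<beta>, 1:] ^ k dvd monv z mon"
      using mon(2) by (meson dvd_trans le_imp_power_dvd)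
  qed
qed

text \<open>After the change of coordinates the restriction sets \<open>x_1 = 0\<close> and
  \<open>x_2 = 1\<close>. In a fixed degree a monomial free of \<open>x_1\<close> is determined by
  its exponent of \<open>x_0\<close>, so there is no cancellation.\<close>

lemma line_restr_eq_0_imp:
  assumes f: "f \<in> forms_deg t" and 0: "line_restr M f = 0"
  shows "\<forall>mon\<in>Poly_Mapping.keys (lsub M f). Poly_Mapping.lookup mon 1 \<noteq> 0"
proof -
  let ?x = "\<lambda>i. if i = 0 then [:0, 1:] else if i = (1::nat) then 0 else 1 :: 'a poly"
  have keys: "mon \<in> tmon" "tdeg mon = t" if "mon \<in> Poly_Mapping.keys (lsub M f)" for mon
    using lsub_in_forms_deg[OF f, of M] that by (auto simp: forms_deg_eq supported_def)
  have "psubst (\<lambda>c. [:c:]) ?x (lsub M f) = line_restr M f"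
    unfolding unital_hom.psubst_lsub[OF unital_hom_const_poly] line_restr_def
    by (simp add: sum_lessThan_3)
  with 0 have "psubst (\<lambda>c. [:c:]) ?x (lsub M f) = 0" by simp
  also have "psubst (\<lambda>c. [:c:]) ?x (lsub M f) = 0
      \<longleftrightarrow> (\<forall>mon\<in>Poly_Mapping.keys (lsub M f). \<not> Poly_Mapping.lookup mon 1 = 0)"
  proof (rule psubst_monom_eq_0_iff)
    show "monv ?x mon = (if Poly_Mapping.lookup mon 1 = 0 then monom 1 (Poly_Mapping.lookup mon 0) else 0)"
      if "mon \<in> Poly_Mapping.keys (lsub M f)" for mon
      by (simp add: monv_tmon[OF keys(1)[OF that]] monom_altdef power_0_left)
    show "inj_on (\<lambda>mon. Poly_Mapping.lookup mon 0)
        {mon \<in> Poly_Mapping.keys (lsub M f). Poly_Mapping.lookup mon 1 = 0}"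
    proof (rule inj_onI, rule tmon_eqI)
      fix x y and i :: nat
      assume xy: "x \<in> {mon \<in> Poly_Mapping.keys (lsub M f). Poly_Mapping.lookup mon 1 = 0}"
        "y \<in> {mon \<in> Poly_Mapping.keys (lsub M f). Poly_Mapping.lookup mon 1 = 0}"
        "Poly_Mapping.lookup x 0 = Poly_Mapping.lookup y 0" and i: "i < 3"
      have "tdeg x = tdeg y" using xy keys(2) by simp
      then show "Poly_Mapping.lookup x i = Poly_Mapping.lookup y i"
        using xy i by (auto simp: tdeg_def numeral_3_eq_3 less_Suc_eq numeral_2_eq_2)
    qed (auto simp: keys)
  qed
  finally show ?thesis .
qed

text \<open>In the frame \<open>L\<close> is \<open>x_1\<close>, which divides every monomial and
  can be taken out termwise. In degree 0 no monomial contains \<open>x_1\<close>, which leaves only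
  \<open>f = 0\<close>.\<close>

lemma line_factor:
  assumes f: "f \<in> forms_deg t" and 0: "line_restr M f = 0" and MN: "inv3 M N" "inv3 N M"
    and LM: "\<And>j. j < 3 \<Longrightarrow> (\<Sum>i<3. coord L i * M i j) = (if j = 1 then 1 else 0)"
  shows "f = 0 \<or> (\<exists>s g. t = Suc s \<and> g \<in> forms_deg s \<and> f = linform (coord L) * g)"
proof (cases t)
  case 0
  have "Poly_Mapping.keys (lsub M f) = {}"
    using line_restr_eq_0_imp[OF f \<open>line_restr M f = 0\<close>] lsub_in_forms_deg[OF f, of M] 0
    by (fastforce simp: forms_deg_eq supported_def tdeg_def)
  then have "lsub M f = 0" by simp
  then have "f = 0"
    using lsub_lsub[of f M N] MN f forms_deg_subset_Rpolys by (auto simp: lsub.hom_zero)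
  then show ?thesis by blast
next
  case (Suc s)
  let ?h = "lsub M f"
  let ?x = "Poly_Mapping.single 1 1 :: nat \<Rightarrow>\<^sub>0 nat"
  define g where "g = (\<Sum>mon\<in>Poly_Mapping.keys ?h. Poly_Mapping.single (mon - ?x) (Poly_Mapping.lookup ?h mon))"
  have mon_eq: "mon = ?x + (mon - ?x)" if "mon \<in> Poly_Mapping.keys ?h" for mon
    using line_restr_eq_0_imp[OF f 0] that
    by (intro poly_mapping_eqI) (auto simp: lookup_add lookup_minus lookup_single when_def)
  have "g \<in> forms_deg s"
    unfolding g_def forms_deg_eq
  proof (intro supported_sum supported_single)
    fix mon assume mon: "mon \<in> Poly_Mapping.keys ?h"
    then have "?x + (mon - ?x) \<in> tmon" "tdeg (?x + (mon - ?x)) = Suc s"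
      using lsub_in_forms_deg[OF f, of M] Suc mon_eq[OF mon, symmetric]
      by (auto simp: forms_deg_eq supported_def)
    then show "mon - ?x \<in> {mon \<in> tmon. tdeg mon = s}"
      by (auto simp: tmon_add_iff tdeg_add) (simp add: tdeg_def lookup_single when_def)
  qed
  have "Poly_Mapping.single ?x 1 * g
      = (\<Sum>mon\<in>Poly_Mapping.keys ?h. Poly_Mapping.single (?x + (mon - ?x)) (Poly_Mapping.lookup ?h mon))"
    unfolding g_def sum_distrib_left mult_single by simp
  also have "\<dots> = (\<Sum>mon\<in>Poly_Mapping.keys ?h. Poly_Mapping.single mon (Poly_Mapping.lookup ?h mon))"
    by (intro sum.cong refl) (simp only: mon_eq[symmetric])
  also have "\<dots> = ?h" by (rule poly_mapping_eq_sum_single[symmetric])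
  finally have h: "?h = Poly_Mapping.single ?x 1 * g" by simp
  have "lsub M (linform (coord L)) = Poly_Mapping.single ?x 1"
    unfolding lsub_linform using LM by (subst linform_unit[of 1 _ 1]) auto
  then have "lsub N (Poly_Mapping.single ?x 1) = linform (coord L)"
    using lsub_lsub[OF linform_in_Rpolys MN(1)] by metis
  then have "lsub N ?h = linform (coord L) * lsub N g"
    by (simp add: h lsub.hom_mult)
  moreover have "lsub N ?h = f"
    using lsub_lsub[of f M N] MN f forms_deg_subset_Rpolys by auto
  ultimately show ?thesis
    using Suc lsub_in_forms_deg[OF \<open>g \<in> forms_deg s\<close>, of N] by auto
qed

lemma sum_order_le_degree:
  fixes F :: "'k::field poly"
  assumes "F \<noteq> 0" "finite A"
  shows "(\<Sum>a\<in>A. order a F) \<le> degree F"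
proof -
  have "(\<Sum>a\<in>A. order a F) = (\<Sum>a\<in>A. count (proots F) a)"
    using assms(1) by simp
  also have "\<dots> = (\<Sum>a\<in>A \<inter> set_mset (proots F). count (proots F) a)"
    using assms(2) by (intro sum.mono_neutral_right) (auto simp: count_eq_zero_iff simp del: set_count_proots count_proots)
  also have "\<dots> \<le> (\<Sum>a\<in>set_mset (proots F). count (proots F) a)"
    by (rule sum_mono2) auto
  also have "\<dots> = size (proots F)" by (simp add: size_multiset_overloaded_eq)
  also have "\<dots> \<le> degree F" by (rule size_proots_le)
  finally show ?thesis .
qed

text \<open>A point of \<open>L\<close> has frame coordinates \<open>n 0\<close>, 0,
  \<open>n 2\<close>. Here \<open>n 2\<close> is nonzero, or else the point would be proportional to
  \<open>b\<close>; so \<open>\<beta> = n 0 / n 2\<close> with scale \<open>n 2\<close>. Points with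
  equal parameters are proportional, hence equal.\<close>

lemma points_on_line_param:
  fixes P :: "'k::field triple set"
  assumes P: "fat_point_support P" and b: "\<forall>p\<in>P. \<forall>c. b \<noteq> smult3 c p" and fr: "is_frame M N b"
    and LM: "\<And>j. j < 3 \<Longrightarrow> (\<Sum>i<3. coord L i * M i j) = (if j = 1 then 1 else 0)"
  shows "\<exists>s \<beta>. inj_on \<beta> {p\<in>P. on_line L p} \<and> (\<forall>p\<in>P. on_line L p \<longrightarrow>
    s p \<noteq> 0 \<and> (\<forall>i<3. coord p i = s p * (M i 2 + \<beta> p * M i 0)))"
proof -
  have MN: "inv3 M N" and Mb: "\<And>i. i < 3 \<Longrightarrow> M i 0 = coord b i"
    using fr by (auto simp: is_frame_def)
  define n where "n j p = (\<Sum>k<3. N j k * coord p k)" for j p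
  define \<beta> where "\<beta> p = n 0 p / n 2 p" for p
  have dec: "coord p i = M i 0 * n 0 p + M i 2 * n 2 p" if "on_line L p" "i < 3" for p i
  proof -
    have "n 1 p = ldot L p"
      unfolding n_def ldot_def using frame_row_eq_line[OF MN LM] by (intro sum.cong) auto
    then show ?thesis
      using inv3_apply[OF MN \<open>i < 3\<close>, of "coord p"] that(1)
      by (simp add: n_def[symmetric] sum_lessThan_3[where g = "\<lambda>j. M i j * n j p"] on_line_iff_ldot)
  qed
  have s: "n 2 p \<noteq> 0" if p: "p \<in> P" "on_line L p" for p
  proof
    assume 0: "n 2 p = 0"
    have eq: "coord p i = n 0 p * coord b i" if "i < 3" for i
      using dec[OF p(2) that] Mb[OF that] 0 by simp
    have "n 0 p \<noteq> 0"
    proof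
      assume "n 0 p = 0"
      then have "p = (0, 0, 0)"
        using eq by (intro triple_eqI) (simp add: coord_def)
      then show False using P p(1) by (auto simp: fat_point_support_def)
    qed
    then have "b = smult3 (1 / n 0 p) p"
      by (intro triple_eqI) (simp add: coord_smult3 eq)
    then show False using b p(1) by blast
  qed
  have c: "coord p i = n 2 p * (M i 2 + \<beta> p * M i 0)" if "p \<in> P" "on_line L p" "i < 3" for p i
    using dec[OF that(2,3)] s[OF that(1,2)] by (simp add: \<beta>_def field_simps)
  have "inj_on \<beta> {p\<in>P. on_line L p}"
  proof (rule inj_onI, rule ccontr)
    fix p q assume pq: "p \<in> {p\<in>P. on_line L p}" "q \<in> {p\<in>P. on_line L p}" "\<beta> p = \<beta> q" "p \<noteq> q"
    have "q = smult3 (n 2 q / n 2 p) p"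
      using pq s by (intro triple_eqI) (simp add: coord_smult3 c)
    then show False using P pq by (auto simp: fat_point_support_def)
  qed
  with s c show ?thesis by (intro exI[of _ "n 2"] exI[of _ \<beta>]) blast
qed

text \<open>A form in the ideal whose restriction to \<open>L\<close> also vanishes at \<open>t + 1 - d\<close> further points
  vanishes on \<open>L\<close>; the evaluations at these points are the functionals to which
  the kernel estimate is applied.\<close>

lemma fat_ideal_dim_le_residual:
  fixes P :: "'k::field triple set"
  assumes inf: "infinite (UNIV :: 'k set)" and P: "fat_point_support P" and L: "L \<noteq> (0, 0, 0)"
  shows "fat_ideal_dim P m t \<le> (if t = 0 then 0 else fat_ideal_dim P (residual L m) (t - 1))
    + (t + 1 - (\<Sum>p\<in>{p\<in>P. on_line L p}. m p))"
proof -
  have P': "finite P" "(0, 0, 0) \<notin> P" using P by (auto simp: fat_point_support_def)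
  let ?Q = "{p\<in>P. on_line L p}"
  let ?V = "fat_ideal P m \<inter> forms_deg t"
  let ?l = "linform (coord L)"
  define d where "d = (\<Sum>p\<in>?Q. m p)"
  obtain b where b: "b \<noteq> (0, 0, 0)" "on_line L b" "\<forall>p\<in>P. \<forall>c. b \<noteq> smult3 c p"
    using point_on_line_avoiding[OF inf P'(1) L] by blast
  obtain M N where fr: "is_frame M N b"
    and LM: "\<And>j. j < 3 \<Longrightarrow> (\<Sum>i<3. coord L i * M i j) = (if j = 1 then 1 else 0)"
    using frame_on_line[OF b(1) L b(2)] by blast
  obtain s \<beta> where inj: "inj_on \<beta> ?Q" and s: "\<forall>p\<in>P. on_line L p \<longrightarrow>
      s p \<noteq> 0 \<and> (\<forall>i<3. coord p i = s p * (M i 2 + \<beta> p * M i 0))"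
    using points_on_line_param[OF P b(3) fr LM] by blast
  have "infinite (UNIV - \<beta> ` ?Q)" using inf P'(1) by (intro Diff_infinite_finite) auto
  \<comment> \<open>Further parameters to vanish at, away from those of the scheme; none if
    \<open>d > t\<close>, by truncated subtraction.\<close>
  from infinite_arbitrarily_large[OF this, of "t + 1 - d"]
  obtain E where E: "finite E" "card E = t + 1 - d" "E \<subseteq> UNIV - \<beta> ` ?Q"
    by blast
  have restr_0: "line_restr M f = 0" if f: "f \<in> ?V" and zero: "\<forall>e\<in>E. poly (line_restr M f) e = 0" for f
  proof (rule ccontr)
    let ?F = "line_restr M f"
    assume F: "?F \<noteq> 0"
    have "m p \<le> order (\<beta> p) ?F" if p: "p \<in> ?Q" for p
    proof -
      have "p \<noteq> (0, 0, 0)" "f \<in> ideal_pow (point_ideal p) (m p)"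
        using p f P'(2) by (auto simp: fat_ideal_def)
      then have "[:- \<beta> p, 1:] ^ m p dvd ?F"
        using line_restr_dvd[OF inf, of p f "m p" "s p" M "\<beta> p"] s p by auto
      then show ?thesis using F by (simp add: order_divides)
    qed
    then have "d \<le> (\<Sum>p\<in>?Q. order (\<beta> p) ?F)" unfolding d_def by (rule sum_mono)
    also have "\<dots> = (\<Sum>a\<in>\<beta> ` ?Q. order a ?F)" by (simp add: sum.reindex[OF inj])
    finally have d: "d \<le> (\<Sum>a\<in>\<beta> ` ?Q. order a ?F)" .
    have "card E \<le> (\<Sum>e\<in>E. order e ?F)"
      using sum_mono[of E "\<lambda>_. 1" "\<lambda>e. order e ?F"] zero F
      by (simp add: order_root Suc_le_eq)
    \<comment> \<open>In all cases \<open>d + card E \<ge> t + 1\<close>, more zeros than the degree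
      \<open>t\<close> permits.\<close>
    with d have "d + card E \<le> (\<Sum>a\<in>\<beta> ` ?Q \<union> E. order a ?F)"
      using E P'(1) by (subst sum.union_disjoint) auto
    also have "\<dots> \<le> degree ?F" using E(1) P'(1) by (intro sum_order_le_degree[OF F]) auto
    also have "\<dots> \<le> t" using f by (intro degree_line_restr_le) auto
    finally show False using E(2) by simp
  qed
  let ?W = "{f\<in>?V. \<forall>e\<in>E. poly (line_restr M f) e = 0}"
  have "mp.dim ?V \<le> mp.dim ?W + card E"
  proof (rule mp.dim_le_kers_add_card[OF E(1) subspace_fat_ideal_forms[OF inf P'(2)]])
    show "?V \<subseteq> mp.span (deg_basis t)" using forms_deg_subset_span by blast
    show "poly (line_restr M (x + y)) e = poly (line_restr M x) e + poly (line_restr M y) e" for x y e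
      by (simp add: line_restr_def unital_hom.psubst_add[OF unital_hom_const_poly])
    show "poly (line_restr M (pscale c x)) e = c * poly (line_restr M x) e" for c x e
      by (simp add: line_restr_def pscale_def unital_hom.psubst_mult[OF unital_hom_const_poly]
          unital_hom.psubst_single[OF unital_hom_const_poly])
  qed (simp add: finite_deg_mons)
  \<comment> \<open>Elements of \<open>?W\<close> restrict to 0, so they are divisible by
    \<open>L\<close>, with quotient in the ideal of the residual.\<close>
  moreover have "mp.dim ?W \<le> (if t = 0 then 0 else fat_ideal_dim P (residual L m) (t - 1))"
  proof -
    have fac: "f = 0 \<or> (\<exists>s g. t = Suc s \<and> g \<in> forms_deg s \<and> f = ?l * g)" if "f \<in> ?W" for f
      using line_factor[OF _ restr_0 _ _ LM, of f t N] that fr by (auto simp: is_frame_def)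
    show ?thesis
    proof (cases t)
      case 0
      then have "?W \<subseteq> mp.span {}" using fac by auto
      then have "mp.dim ?W \<le> card ({} :: 'k mpoly set)" by (rule mp.dim_le_card) simp
      then show ?thesis using 0 by simp
    next
      case (Suc r)
      have "?W \<subseteq> (*) ?l ` (fat_ideal P (residual L m) \<inter> forms_deg r)"
      proof
        fix f assume f: "f \<in> ?W"
        have "\<exists>g\<in>forms_deg r. f = ?l * g"
        proof (cases "f = 0")
          case True
          then show ?thesis by (intro bexI[of _ 0]) (auto simp: forms_deg_eq)
        next
          case False
          then show ?thesis using fac[OF f] Suc by auto
        qed
        then obtain g where g: "g \<in> forms_deg r" "f = ?l * g" by blast
        then have "g \<in> fat_ideal P (residual L m)"
          using f linform_mult_in_fat_ideal_iff[OF inf P'(2) L, of g m] forms_deg_subset_Rpolys by auto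
        with g show "f \<in> (*) ?l ` (fat_ideal P (residual L m) \<inter> forms_deg r)" by auto
      qed
      moreover have "(*) ?l ` (fat_ideal P (residual L m) \<inter> forms_deg r) \<subseteq> mp.span (deg_basis t)"
        using linform_mult_image_subset[OF inf P'(2) L, of m r] forms_deg_subset_span[of t] Suc by blast
      ultimately have "mp.dim ?W \<le> mp.dim ((*) ?l ` (fat_ideal P (residual L m) \<inter> forms_deg r))"
        by (rule mp.dim_subset_finite_span) (simp add: finite_deg_mons)
      then show ?thesis
        using Suc by (simp add: dim_linform_mult_image[OF L] fat_ideal_dim_def kdim_def)
    qed
  qed
  ultimately show ?thesis
    unfolding E(2) d_def by (simp add: fat_ideal_dim_def kdim_def)
qed

section \<open>Iteration of the upper bound and conclusion\<close>

lemma bnm_nonneg: "bnm a k \<ge> 0"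
  by (simp add: bnm_def)

lemma bnm_of_nat: "bnm (int a) k = int (a choose k)"
  by (simp add: bnm_def binomial_eq_0)

lemma fat_ideal_dim_le_forms: "fat_ideal_dim (P :: 'k::field triple set) m t \<le> (t + 2) choose 2"
proof -
  have "mp.dim (fat_ideal P m \<inter> forms_deg t) \<le> mp.dim (forms_deg t :: 'k mpoly set)"
    by (rule mp.dim_subset_finite_span[OF _ forms_deg_subset_span]) (auto simp: finite_deg_mons)
  then show ?thesis using kdim_forms_deg[where 'k = 'k, of t] by (simp add: fat_ideal_dim_def kdim_def)
qed

text \<open>Downward from \<open>k = n + 1\<close>, where the dimension is bounded by that of all
  forms. Each line lowers the degree by one, so \<open>t\<close> varies in the induction while
  \<open>t + k\<close> stays the same.\<close>

lemma fat_ideal_dim_res_seq_upper: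
  fixes P :: "'k::field triple set"
  assumes inf: "infinite (UNIV :: 'k set)" and P: "fat_point_support P"
    and tr: "totally_reduces P m L n" and k: "k \<le> n + 1"
  shows "int (fat_ideal_dim P (res_seq m L k) t) \<le> bnm (int t + int k - int n + 1) 2
    + (\<Sum>i=k..n. max (int t + int k - int i - int (red_vec P m L (i + 1)) + 1) 0)"
  using k
proof (induction k arbitrary: t rule: inc_induct)
  case base
  have "int t + int (n + 1) - int n + 1 = int (t + 2)" by simp
  then show ?case
    using fat_ideal_dim_le_forms[of P _ t] bnm_of_nat[of "t + 2" 2] by (simp del: of_nat_add)
next
  case (step k)
  let ?d = "red_vec P m L"
  let ?S = "\<lambda>k t. \<Sum>i=k..n. max (int t + int k - int i - int (?d (i + 1)) + 1) 0"
  have k: "k \<le> n" using step.hyps by simp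
  have L: "L (Suc k) \<noteq> (0, 0, 0)" using tr k by (auto simp: totally_reduces_def)
  have "fat_ideal_dim P (res_seq m L k) t
      \<le> (if t = 0 then 0 else fat_ideal_dim P (res_seq m L (Suc k)) (t - 1)) + (t + 1 - ?d (Suc k))"
    using fat_ideal_dim_le_residual[OF inf P L, of "res_seq m L k" t]
    by (cases "t = 0") (simp_all add: red_vec_def)
  then have le: "int (fat_ideal_dim P (res_seq m L k) t)
      \<le> int (if t = 0 then 0 else fat_ideal_dim P (res_seq m L (Suc k)) (t - 1)) + max (int t - int (?d (Suc k)) + 1) 0"
    by linarith
  have S: "?S k t = max (int t - int (?d (Suc k)) + 1) 0
      + (\<Sum>i=Suc k..n. max (int t + int k - int i - int (?d (i + 1)) + 1) 0)"
    using k by (simp add: sum.atLeast_Suc_atMost)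
  show ?case
  proof (cases t)
    case 0
    \<comment> \<open>In degree 0 nothing is left to divide by the line; the remaining terms of the
      bound are merely non-negative.\<close>
    have "0 \<le> (\<Sum>i=Suc k..n. max (int t + int k - int i - int (?d (i + 1)) + 1) 0)"
      by (rule sum_nonneg) simp
    then show ?thesis
      using le S 0 bnm_nonneg[of "int t + int k - int n + 1" 2] by simp
  next
    case (Suc r)
    then show ?thesis
      using le S step.IH[of r] by (simp add: algebra_simps)
  qed
qed

lemma fat_ideal_dim_le_hsum:
  fixes P :: "'k::field triple set"
  assumes "infinite (UNIV :: 'k set)" "fat_point_support P" "totally_reduces P m L n"
  shows "int (fat_ideal_dim P m t) \<le> hsum n t (red_vec P m L)"
  using fat_ideal_dim_res_seq_upper[OF assms, of 0 t] by (simp add: hsum_def bnm_1[simplified])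

theorem theorem2p2p2:
  fixes P :: "('k::alg_closed_field) triple set"
    and m :: "'k triple \<Rightarrow> nat"
    and L :: "nat \<Rightarrow> 'k triple"
    and n :: nat
  assumes "fat_point_support P"
    and "totally_reduces P m L n"
    and "is_GMS (n + 1) (red_vec P m L)"
  shows "\<forall>t::nat.
     (let d = red_vec P m L;
          h' = (\<lambda>i. bnm (int t - int i + 2) 2 - (\<Sum>j=i+1..n+1. int (d j)));
          rhs = bnm (int t - int n + 1) 2 + (\<Sum>i=0..n. bnm (int t - int i - int (d (i + 1)) + 1) 1)
      in Max (h' ` {0..n+1}) = rhs
         \<and> int (fat_ideal_dim P m t) = rhs
         \<and> hilb P m t = f_vec n d t
         \<and> hilb P m t = F_vec n d t)"
proof
  fix t :: nat
  let ?d = "red_vec P m L"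
  have max: "Max (hcand n t ?d ` {0..n+1}) = hsum n t ?d" by (rule Max_hcand[OF assms(3)])
  \<comment> \<open>At the index where h'_i equals the upper bound, the dimension is squeezed
    between the two.\<close>
  obtain i where "i \<le> n + 1" "hcand n t ?d i = hsum n t ?d"
    using hsum_attained[OF assms(3)] by blast
  then have dim: "int (fat_ideal_dim P m t) = hsum n t ?d"
    using hcand_le_fat_ideal_dim[OF alg_closed_infinite assms(1,2), of i t]
      fat_ideal_dim_le_hsum[OF alg_closed_infinite assms(1,2), of t] by simp
  have "hilb P m t = bnm (int t + 2) 2 - hsum n t ?d"
    using dim bnm_of_nat[of "t + 2" 2] by (simp add: hilb_def kdim_forms_deg add.commute)
  then show "let d = red_vec P m L;
          h' = (\<lambda>i. bnm (int t - int i + 2) 2 - (\<Sum>j=i+1..n+1. int (d j)));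
          rhs = bnm (int t - int n + 1) 2 + (\<Sum>i=0..n. bnm (int t - int i - int (d (i + 1)) + 1) 1)
      in Max (h' ` {0..n+1}) = rhs
         \<and> int (fat_ideal_dim P m t) = rhs
         \<and> hilb P m t = f_vec n d t
         \<and> hilb P m t = F_vec n d t"
    using max dim f_vec_eq[of n ?d t] F_vec_eq[OF assms(3), of t]
    unfolding Let_def hcand_def hsum_def by metis
qed

end
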